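(* Let $n\ge2$, let $\mathcal P$ be a class of groups closed under extensions and homomorphic images, let $f\colon\Gamma\to G$ be a group homomorphism, and let $p\colon\widetilde G\to G$ be an $f$-extension. \begin{enumerate} \item If $\ker p\subseteq Z_{n-1}(\widetilde G)$, $M_n^{\otimes}(f)\in\mathcal P$ and $\gamma_n(G)\in\mathcal P$, then $\gamma_n(\widetilde G)\in\mathcal P$. \item If $\ker p\subseteq\mathfrak D_{n-1}(\widetilde G)$, $M_n^{\wedge}(f)\in\mathcal P$ and $\Gamma_n(G)\in\mathcal P$, then $\Gamma_n(\widetilde G)\in\mathcal P$. \end{enumerate}
   Context: An $f$-extension of $G$, for $f\colon\Gamma\to G$, is an epimorphism $p\colon\widetilde G\to G$ for which there is a homomorphism $\widetilde f\colon\Gamma\to\widetilde G$ with $p\widetilde f=f$. Write $[x,y]=xyx^{-1}y^{-1}$, ${}^{x}y=xyx^{-1}$. $Z_k(G)$ is the $k$-th term of the upper central series ($Z_0=1$, $Z_1=Z(G)$). Lower central series: $\gamma_1(G)=G$, $\gamma_{k+1}(G)=[\gamma_k(G),G]$. Derived series: $\Gamma_1(G)=G$, $\Gamma_{k+1}(G)=[\Gamma_k(G),\Gamma_k(G)]$. For $k\ge1$, $\mathfrak D_k(G)$ is the set of $g\in G$ such that $[\cdots[[g,x_1],x_2],\ldots,x_k]=1$ for all $x_i\in\Gamma_i(G)$, $i=1,\dots,k$. For groups $M,N$ acting compatibly on each other (and on themselves by conjugation), the non-abelian tensor product $M\otimes N$ (Brown–Loday) is the group generated by symbols $m\otimes x$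 ($m\in M,x\in N$) with relations $mm'\otimes x=({}^{m}m'\otimes{}^{m}x)(m\otimes x)$ and $m\otimes xx'=(m\otimes x)({}^{x}m\otimes{}^{x}x')$. The exterior square $M\wedge M$ is the quotient of $M\otimes M$ (conjugation actions) by the normal closure of all $m\otimes m$. Tensor powers: $G^{\otimes1}=G$, $\lambda_1^G=\mathrm{id}$, and $G^{\otimes(n+1)}=G^{\otimes n}\otimes G$, where $G$ acts on $G^{\otimes n}$ diagonally (by conjugation on each factor) and $G^{\otimes n}$ acts on $G$ by conjugation through $\lambda_n^G\colon G^{\otimes n}\to G$; $\lambda_{n+1}^G(x\otimes g)=[\lambda_n^G(x),g]$. Exterior powers: $G^{\wedge(1)}=G$, $\mu_1^G=\mathrm{id}$, $G^{\wedge(n+1)}=G^{\wedge(n)}\wedge G^{\wedge(n)}$, with $\mu_{n+1}^G\colon G^{\wedge(n+1)}\to G$, $\mu_{n+1}^G(a\wedge b)=[\mu_n^G(a),\mu_n^G(b)]$. All these constructions are functorial in $G$. Put $K_n^{\otimes}(G)=\ker\lambda_n^G$ and $K_n^{\wedge}(G)=\ker\mu_n^G$. For $f\colon\Gamma\to G$ let $N_n^{\otimes}(f)$ be the normal closure in $G^{\otimes n}$ of $f^{\otimes n}(K_n^{\otimes}(\Gamma))$ and $N_n^{\wedge}(f)$ the normal closure in $G^{\wedge(n)}$ of $f^{\wedge(n)}(K_n^{\wedge}(\Gamma))$; put $M_n^{\otimes}(f)=K_n^{\otimes}(G)/N_n^{\otimes}(f)$ and $M_n^{\wedge}(f)=K_n^{\wedge}(G)/N_n^{\wedge}(f)$.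 *)

theory Defs
  imports "HOL-Algebra.Exact_Sequence" "HOL-Algebra.Weak_Morphisms"
begin

section \<open>Commutators and series\<close>

definition conjugate :: "('a, 'z) monoid_scheme \<Rightarrow> 'a \<Rightarrow> 'a \<Rightarrow> 'a" where
  "conjugate G x y = x \<otimes>\<^bsub>G\<^esub> y \<otimes>\<^bsub>G\<^esub> inv\<^bsub>G\<^esub> x"

definition commutator :: "('a, 'z) monoid_scheme \<Rightarrow> 'a \<Rightarrow> 'a \<Rightarrow> 'a" where
  "commutator G x y = x \<otimes>\<^bsub>G\<^esub> y \<otimes>\<^bsub>G\<^esub> inv\<^bsub>G\<^esub> x \<otimes>\<^bsub>G\<^esub> inv\<^bsub>G\<^esub> y"

definition commutator_subgroup :: "('a, 'z) monoid_scheme \<Rightarrow> 'a set \<Rightarrow> 'a set \<Rightarrow> 'a set" where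
  "commutator_subgroup G A B = generate G {commutator G a b | a b. a \<in> A \<and> b \<in> B}"

text \<open>Both series start at index 1, with the whole group; index 0 is not used.\<close>

definition lower_central :: "('a, 'z) monoid_scheme \<Rightarrow> nat \<Rightarrow> 'a set" where
  "lower_central G k = ((\<lambda>H. commutator_subgroup G H (carrier G)) ^^ (k - 1)) (carrier G)"

definition derived_series :: "('a, 'z) monoid_scheme \<Rightarrow> nat \<Rightarrow> 'a set" where
  "derived_series G k = (derived G ^^ (k - 1)) (carrier G)"

primrec upper_central :: "('a, 'z) monoid_scheme \<Rightarrow> nat \<Rightarrow> 'a set" where
  "upper_central G 0 = {\<one>\<^bsub>G\<^esub>}"
| "upper_central G (Suc k) =
     {g \<in> carrier G. \<forall>x \<in> carrier G. commutator G g x \<in> upper_central G k}"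

text \<open>The set \<open>\<DD>\<^sub>k(G)\<close> of all \<open>g\<close> with \<open>[\<dots>[[g, x\<^sub>1], x\<^sub>2], \<dots>, x\<^sub>k] = 1\<close> whenever each
  \<open>x\<^sub>i\<close> lies in the \<open>i\<close>-th term of the derived series; it need not be a subgroup.\<close>

definition derived_annihilator :: "('a, 'z) monoid_scheme \<Rightarrow> nat \<Rightarrow> 'a set" where
  "derived_annihilator G k =
     {g \<in> carrier G. \<forall>x. (\<forall>i \<in> {1..k}. x i \<in> derived_series G i)
        \<longrightarrow> foldl (commutator G) g (map x [1..<Suc k]) = \<one>\<^bsub>G\<^esub>}"

definition normal_closure :: "('a, 'z) monoid_scheme \<Rightarrow> 'a set \<Rightarrow> 'a set" where
  "normal_closure G S = \<Inter>{N. N \<lhd> G \<and> S \<subseteq> N}"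


section \<open>Groups given by generators and relations\<close>

text \<open>In a word, the letter \<open>(x, True)\<close> stands for the generator \<open>x\<close> and \<open>(x, False)\<close> for its
  inverse.  Relations are pairs of words.\<close>

type_synonym 'x word = "('x \<times> bool) list"

inductive_set word_cong :: "'x set \<Rightarrow> ('x word \<times> 'x word) set \<Rightarrow> ('x word \<times> 'x word) set"
  for Y :: "'x set" and R :: "('x word \<times> 'x word) set"
where
  refl: "u \<in> lists (Y \<times> UNIV) \<Longrightarrow> (u, u) \<in> word_cong Y R"
| sym: "(u, v) \<in> word_cong Y R \<Longrightarrow> (v, u) \<in> word_cong Y R"
| trans: "(u, v) \<in> word_cong Y R \<Longrightarrow> (v, w) \<in> word_cong Y R \<Longrightarrow> (u, w) \<in> word_cong Y R"
| append: "(u, u') \<in> word_cong Y R \<Longrightarrow> (v, v') \<in> word_cong Y R \<Longrightarrow>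
    (u @ v, u' @ v') \<in> word_cong Y R"
| cancel: "x \<in> Y \<Longrightarrow> ([(x, b), (x, \<not> b)], []) \<in> word_cong Y R"
| relation: "(u, v) \<in> R \<Longrightarrow> u \<in> lists (Y \<times> UNIV) \<Longrightarrow> v \<in> lists (Y \<times> UNIV) \<Longrightarrow>
    (u, v) \<in> word_cong Y R"

definition presented_group :: "'x set \<Rightarrow> ('x word \<times> 'x word) set \<Rightarrow> 'x word set monoid" where
  "presented_group Y R =
     \<lparr>carrier = lists (Y \<times> UNIV) // word_cong Y R,
      mult = (\<lambda>A B. \<Union>u \<in> A. \<Union>v \<in> B. word_cong Y R `` {u @ v}),
      one = word_cong Y R `` {[]}\<rparr>"

primrec word_eval :: "('h, 'z) monoid_scheme \<Rightarrow> ('x \<Rightarrow> 'h) \<Rightarrow> 'x word \<Rightarrow> 'h" where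
  "word_eval H \<phi> [] = \<one>\<^bsub>H\<^esub>"
| "word_eval H \<phi> (l # w) =
     (if snd l then \<phi> (fst l) else inv\<^bsub>H\<^esub> (\<phi> (fst l))) \<otimes>\<^bsub>H\<^esub> word_eval H \<phi> w"

text \<open>The homomorphism from a presented group to \<open>H\<close> given by \<open>\<phi>\<close> on generators; it is meaningful
  only if \<open>\<phi>\<close> respects the relations, so that \<open>word_eval\<close> is constant on each class.\<close>

definition presented_lift :: "('h, 'z) monoid_scheme \<Rightarrow> ('x \<Rightarrow> 'h) \<Rightarrow> 'x word set \<Rightarrow> 'h" where
  "presented_lift H \<phi> C = the_elem (word_eval H \<phi> ` C)"


section \<open>Non-abelian tensor product and exterior square\<close>

text \<open>Here \<open>a m x\<close> is the action of \<open>m \<in> M\<close> on \<open>x \<in> N\<close> and \<open>b x m\<close> that of \<open>x\<close> on \<open>m\<close>;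
  each group acts on itself by conjugation.  The generator \<open>(m, x)\<close> is the symbol \<open>m \<otimes> x\<close>.\<close>

definition tensor_relations ::
  "('m, 'y) monoid_scheme \<Rightarrow> ('n, 'z) monoid_scheme \<Rightarrow> ('m \<Rightarrow> 'n \<Rightarrow> 'n) \<Rightarrow> ('n \<Rightarrow> 'm \<Rightarrow> 'm) \<Rightarrow>
   (('m \<times> 'n) word \<times> ('m \<times> 'n) word) set" where
  "tensor_relations M N a b =
     {([((m \<otimes>\<^bsub>M\<^esub> m', x), True)],
       [((conjugate M m m', a m x), True), ((m, x), True)]) | m m' x.
        m \<in> carrier M \<and> m' \<in> carrier M \<and> x \<in> carrier N}
   \<union> {([((m, x \<otimes>\<^bsub>N\<^esub> x'), True)],
       [((m, x), True), ((b x m, conjugate N x x'), True)]) | m x x'.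
        m \<in> carrier M \<and> x \<in> carrier N \<and> x' \<in> carrier N}"

definition tensor_product ::
  "('m, 'y) monoid_scheme \<Rightarrow> ('n, 'z) monoid_scheme \<Rightarrow> ('m \<Rightarrow> 'n \<Rightarrow> 'n) \<Rightarrow> ('n \<Rightarrow> 'm \<Rightarrow> 'm) \<Rightarrow>
   ('m \<times> 'n) word set monoid" where
  "tensor_product M N a b =
     presented_group (carrier M \<times> carrier N) (tensor_relations M N a b)"

definition tensor_symbol ::
  "('m, 'y) monoid_scheme \<Rightarrow> ('n, 'z) monoid_scheme \<Rightarrow> ('m \<Rightarrow> 'n \<Rightarrow> 'n) \<Rightarrow> ('n \<Rightarrow> 'm \<Rightarrow> 'm) \<Rightarrow>
   'm \<Rightarrow> 'n \<Rightarrow> ('m \<times> 'n) word set" where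
  "tensor_symbol M N a b m x =
     word_cong (carrier M \<times> carrier N) (tensor_relations M N a b) `` {[((m, x), True)]}"

definition tensor_square :: "('m, 'z) monoid_scheme \<Rightarrow> ('m \<times> 'm) word set monoid" where
  "tensor_square M = tensor_product M M (conjugate M) (conjugate M)"

definition square_symbol :: "('m, 'z) monoid_scheme \<Rightarrow> 'm \<Rightarrow> 'm \<Rightarrow> ('m \<times> 'm) word set" where
  "square_symbol M = tensor_symbol M M (conjugate M) (conjugate M)"

definition exterior_kernel :: "('m, 'z) monoid_scheme \<Rightarrow> ('m \<times> 'm) word set set" where
  "exterior_kernel M =
     normal_closure (tensor_square M) {square_symbol M m m | m. m \<in> carrier M}"

definition exterior_square :: "('m, 'z) monoid_scheme \<Rightarrow> ('m \<times> 'm) word set set monoid" where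
  "exterior_square M = tensor_square M Mod exterior_kernel M"

definition wedge_symbol :: "('m, 'z) monoid_scheme \<Rightarrow> 'm \<Rightarrow> 'm \<Rightarrow> ('m \<times> 'm) word set set" where
  "wedge_symbol M a b = exterior_kernel M #>\<^bsub>tensor_square M\<^esub> square_symbol M a b"

definition exterior_lift ::
  "('h, 'z) monoid_scheme \<Rightarrow> ('m \<times> 'm \<Rightarrow> 'h) \<Rightarrow> ('m \<times> 'm) word set set \<Rightarrow> 'h" where
  "exterior_lift H \<phi> C = the_elem (presented_lift H \<phi> ` C)"


section \<open>Tensor powers\<close>

text \<open>A recursion over \<open>n\<close> needs one type for the elements of all tensor powers of a group.  After
  each tensor product the elements, which are classes of words, are therefore encoded by a chosen
  word in the class, and the group structure is transported along this injection.\<close>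

datatype 'a tensor_elt =
    Tensor_Base (tensor_base: 'a)
  | Tensor_Word "(('a tensor_elt \<times> 'a) \<times> bool) list"

definition tensor_code :: "('a tensor_elt \<times> 'a) word set \<Rightarrow> 'a tensor_elt" where
  "tensor_code C = Tensor_Word (SOME w. w \<in> C)"

text \<open>A tensor power \<open>T\<close> of \<open>G\<close> together with the diagonal action of \<open>G\<close> on \<open>T\<close> and the
  commutator map \<open>\<lambda> : T \<rightarrow> G\<close>.\<close>

record 'a tensor_stage =
  stage_group :: "'a tensor_elt monoid"
  stage_act :: "'a \<Rightarrow> 'a tensor_elt \<Rightarrow> 'a tensor_elt"
  stage_lambda :: "'a tensor_elt \<Rightarrow> 'a"

definition stage_act_back ::
  "('a, 'z) monoid_scheme \<Rightarrow> 'a tensor_stage \<Rightarrow> 'a tensor_elt \<Rightarrow> 'a \<Rightarrow> 'a" where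
  "stage_act_back G S t g = conjugate G (stage_lambda S t) g"

definition next_tensor ::
  "('a, 'z) monoid_scheme \<Rightarrow> 'a tensor_stage \<Rightarrow> ('a tensor_elt \<times> 'a) word set monoid" where
  "next_tensor G S = tensor_product (stage_group S) G (stage_act_back G S) (stage_act S)"

definition next_symbol ::
  "('a, 'z) monoid_scheme \<Rightarrow> 'a tensor_stage \<Rightarrow> 'a tensor_elt \<Rightarrow> 'a \<Rightarrow> 'a tensor_elt" where
  "next_symbol G S t g =
     tensor_code (tensor_symbol (stage_group S) G (stage_act_back G S) (stage_act S) t g)"

definition next_lift ::
  "('a, 'z) monoid_scheme \<Rightarrow> 'a tensor_stage \<Rightarrow> ('h, 'y) monoid_scheme \<Rightarrow>
   ('a tensor_elt \<times> 'a \<Rightarrow> 'h) \<Rightarrow> 'a tensor_elt \<Rightarrow> 'h" where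
  "next_lift G S H \<phi> t =
     presented_lift H \<phi> (inv_into (carrier (next_tensor G S)) tensor_code t)"

definition next_stage :: "('a, 'z) monoid_scheme \<Rightarrow> 'a tensor_stage \<Rightarrow> 'a tensor_stage" where
  "next_stage G S =
     \<lparr>stage_group = image_group tensor_code (next_tensor G S),
      stage_act = (\<lambda>g. next_lift G S (image_group tensor_code (next_tensor G S))
        (\<lambda>(t, h). next_symbol G S (stage_act S g t) (conjugate G g h))),
      stage_lambda = next_lift G S G (\<lambda>(t, g). commutator G (stage_lambda S t) g)\<rparr>"

text \<open>Stage \<open>k\<close> is the tensor power with \<open>k + 1\<close> factors.\<close>

primrec tensor_stages :: "('a, 'z) monoid_scheme \<Rightarrow> nat \<Rightarrow> 'a tensor_stage" where
  "tensor_stages G 0 =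
     \<lparr>stage_group = image_group Tensor_Base G,
      stage_act = (\<lambda>g t. Tensor_Base (conjugate G g (tensor_base t))),
      stage_lambda = tensor_base\<rparr>"
| "tensor_stages G (Suc k) = next_stage G (tensor_stages G k)"

primrec tensor_stage_map ::
  "('c, 'y) monoid_scheme \<Rightarrow> ('a, 'z) monoid_scheme \<Rightarrow> ('c \<Rightarrow> 'a) \<Rightarrow> nat \<Rightarrow>
   'c tensor_elt \<Rightarrow> 'a tensor_elt" where
  "tensor_stage_map \<Gamma> G f 0 = (\<lambda>t. Tensor_Base (f (tensor_base t)))"
| "tensor_stage_map \<Gamma> G f (Suc k) =
     next_lift \<Gamma> (tensor_stages \<Gamma> k) (stage_group (tensor_stages G (Suc k)))
       (\<lambda>(t, x). next_symbol G (tensor_stages G k) (tensor_stage_map \<Gamma> G f k t) (f x))"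

text \<open>The exponent \<open>n\<close> is at least 1 from here on.\<close>

definition tensor_power :: "('a, 'z) monoid_scheme \<Rightarrow> nat \<Rightarrow> 'a tensor_elt monoid" where
  "tensor_power G n = stage_group (tensor_stages G (n - 1))"

definition tensor_lambda :: "('a, 'z) monoid_scheme \<Rightarrow> nat \<Rightarrow> 'a tensor_elt \<Rightarrow> 'a" where
  "tensor_lambda G n = stage_lambda (tensor_stages G (n - 1))"

definition tensor_power_map ::
  "('c, 'y) monoid_scheme \<Rightarrow> ('a, 'z) monoid_scheme \<Rightarrow> ('c \<Rightarrow> 'a) \<Rightarrow> nat \<Rightarrow>
   'c tensor_elt \<Rightarrow> 'a tensor_elt" where
  "tensor_power_map \<Gamma> G f n = tensor_stage_map \<Gamma> G f (n - 1)"

definition K_tensor :: "('a, 'z) monoid_scheme \<Rightarrow> nat \<Rightarrow> 'a tensor_elt set" where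
  "K_tensor G n = kernel (tensor_power G n) G (tensor_lambda G n)"

definition N_tensor ::
  "('c, 'y) monoid_scheme \<Rightarrow> ('a, 'z) monoid_scheme \<Rightarrow> ('c \<Rightarrow> 'a) \<Rightarrow> nat \<Rightarrow> 'a tensor_elt set" where
  "N_tensor \<Gamma> G f n =
     normal_closure (tensor_power G n) (tensor_power_map \<Gamma> G f n ` K_tensor \<Gamma> n)"

definition M_tensor ::
  "('c, 'y) monoid_scheme \<Rightarrow> ('a, 'z) monoid_scheme \<Rightarrow> ('c \<Rightarrow> 'a) \<Rightarrow> nat \<Rightarrow>
   'a tensor_elt set monoid" where
  "M_tensor \<Gamma> G f n = (tensor_power G n)\<lparr>carrier := K_tensor G n\<rparr> Mod N_tensor \<Gamma> G f n"


section \<open>Exterior powers\<close>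

text \<open>Elements of an exterior square are cosets of classes of words; they are encoded by a word in
  one of the classes.\<close>

datatype 'a wedge_elt =
    Wedge_Base (wedge_base: 'a)
  | Wedge_Word "(('a wedge_elt \<times> 'a wedge_elt) \<times> bool) list"

definition wedge_code :: "('a wedge_elt \<times> 'a wedge_elt) word set set \<Rightarrow> 'a wedge_elt" where
  "wedge_code C = Wedge_Word (SOME w. w \<in> \<Union>C)"

definition next_wedge_symbol ::
  "'a wedge_elt monoid \<Rightarrow> 'a wedge_elt \<Rightarrow> 'a wedge_elt \<Rightarrow> 'a wedge_elt" where
  "next_wedge_symbol E a b = wedge_code (wedge_symbol E a b)"

definition next_wedge_lift ::
  "'a wedge_elt monoid \<Rightarrow> ('h, 'y) monoid_scheme \<Rightarrow> ('a wedge_elt \<times> 'a wedge_elt \<Rightarrow> 'h) \<Rightarrow>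
   'a wedge_elt \<Rightarrow> 'h" where
  "next_wedge_lift E H \<phi> t =
     exterior_lift H \<phi> (inv_into (carrier (exterior_square E)) wedge_code t)"

text \<open>Stage \<open>k\<close> is the exterior power with index \<open>k + 1\<close>.\<close>

primrec wedge_stage :: "('a, 'z) monoid_scheme \<Rightarrow> nat \<Rightarrow> 'a wedge_elt monoid" where
  "wedge_stage G 0 = image_group Wedge_Base G"
| "wedge_stage G (Suc k) = image_group wedge_code (exterior_square (wedge_stage G k))"

primrec wedge_stage_mu :: "('a, 'z) monoid_scheme \<Rightarrow> nat \<Rightarrow> 'a wedge_elt \<Rightarrow> 'a" where
  "wedge_stage_mu G 0 = wedge_base"
| "wedge_stage_mu G (Suc k) =
     next_wedge_lift (wedge_stage G k) G
       (\<lambda>(a, b). commutator G (wedge_stage_mu G k a) (wedge_stage_mu G k b))"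

primrec wedge_stage_map ::
  "('c, 'y) monoid_scheme \<Rightarrow> ('a, 'z) monoid_scheme \<Rightarrow> ('c \<Rightarrow> 'a) \<Rightarrow> nat \<Rightarrow>
   'c wedge_elt \<Rightarrow> 'a wedge_elt" where
  "wedge_stage_map \<Gamma> G f 0 = (\<lambda>t. Wedge_Base (f (wedge_base t)))"
| "wedge_stage_map \<Gamma> G f (Suc k) =
     next_wedge_lift (wedge_stage \<Gamma> k) (wedge_stage G (Suc k))
       (\<lambda>(a, b). next_wedge_symbol (wedge_stage G k)
          (wedge_stage_map \<Gamma> G f k a) (wedge_stage_map \<Gamma> G f k b))"

definition exterior_power :: "('a, 'z) monoid_scheme \<Rightarrow> nat \<Rightarrow> 'a wedge_elt monoid" where
  "exterior_power G n = wedge_stage G (n - 1)"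

definition exterior_mu :: "('a, 'z) monoid_scheme \<Rightarrow> nat \<Rightarrow> 'a wedge_elt \<Rightarrow> 'a" where
  "exterior_mu G n = wedge_stage_mu G (n - 1)"

definition exterior_power_map ::
  "('c, 'y) monoid_scheme \<Rightarrow> ('a, 'z) monoid_scheme \<Rightarrow> ('c \<Rightarrow> 'a) \<Rightarrow> nat \<Rightarrow>
   'c wedge_elt \<Rightarrow> 'a wedge_elt" where
  "exterior_power_map \<Gamma> G f n = wedge_stage_map \<Gamma> G f (n - 1)"

definition K_wedge :: "('a, 'z) monoid_scheme \<Rightarrow> nat \<Rightarrow> 'a wedge_elt set" where
  "K_wedge G n = kernel (exterior_power G n) G (exterior_mu G n)"

definition N_wedge ::
  "('c, 'y) monoid_scheme \<Rightarrow> ('a, 'z) monoid_scheme \<Rightarrow> ('c \<Rightarrow> 'a) \<Rightarrow> nat \<Rightarrow> 'a wedge_elt set" where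
  "N_wedge \<Gamma> G f n =
     normal_closure (exterior_power G n) (exterior_power_map \<Gamma> G f n ` K_wedge \<Gamma> n)"

definition M_wedge ::
  "('c, 'y) monoid_scheme \<Rightarrow> ('a, 'z) monoid_scheme \<Rightarrow> ('c \<Rightarrow> 'a) \<Rightarrow> nat \<Rightarrow>
   'a wedge_elt set monoid" where
  "M_wedge \<Gamma> G f n = (exterior_power G n)\<lparr>carrier := K_wedge G n\<rparr> Mod N_wedge \<Gamma> G f n"


section \<open>Extensions and classes of groups\<close>

definition f_extension ::
  "('c, 'x) monoid_scheme \<Rightarrow> ('a, 'y) monoid_scheme \<Rightarrow> ('c \<Rightarrow> 'a) \<Rightarrow>
   ('b, 'z) monoid_scheme \<Rightarrow> ('b \<Rightarrow> 'a) \<Rightarrow> bool" where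
  "f_extension \<Gamma> G f G' p \<longleftrightarrow>
     p \<in> epi G' G \<and> (\<exists>f' \<in> hom \<Gamma> G'. \<forall>x \<in> carrier \<Gamma>. p (f' x) = f x)"

text \<open>A class of groups is given by its members with elements in a fixed infinite type \<open>'u\<close>, which
  serves as a universe and may be arbitrarily large; a group of another type belongs to the class if
  it is isomorphic to one of these members.  A finite \<open>'u\<close> would not do, since there an extension of
  two groups can be too large to have a copy in \<open>'u\<close>.\<close>

definition closed_group_class :: "('u monoid \<Rightarrow> bool) \<Rightarrow> bool" where
  "closed_group_class P \<longleftrightarrow>
     (\<forall>H. P H \<longrightarrow> group H)
   \<and> (\<forall>H K h. P H \<and> group K \<and> h \<in> epi H K \<longrightarrow> P K)
   \<and> (\<forall>A E B i q. P A \<and> P B \<and> short_exact_sequence B E A q i \<longrightarrow> P E)"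

definition in_group_class :: "('u monoid \<Rightarrow> bool) \<Rightarrow> ('a, 'z) monoid_scheme \<Rightarrow> bool" where
  "in_group_class P H \<longleftrightarrow> (\<exists>K. P K \<and> H \<cong> K)"

end

theory Submission
  imports Defs
begin

text \<open>
  Write \<open>E\<close> for the group \<open>G'\<close> of the extension \<open>p : E \<rightarrow> G\<close> and let \<open>A\<close> be the kernel of \<open>p\<close>.
  If \<open>A\<close> lies in the term \<open>Z\<^sub>n\<^sub>-\<^sub>1(E)\<close> of the upper central series, then an \<open>n\<close>-fold commutator in \<open>E\<close>
  depends only on the images in \<open>G\<close> of its entries, so there is a homomorphism \<open>\<delta>\<close> from the \<open>n\<close>-th
  tensor power of \<open>G\<close> to \<open>E\<close> that forms commutators of arbitrary preimages.  Its image is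
  \<open>\<gamma>\<^sub>n(E)\<close> and \<open>p \<circ> \<delta> = \<lambda>\<^sub>n\<close>, hence \<open>\<delta>\<close> maps the kernel of \<open>\<lambda>\<^sub>n\<close> onto the kernel of the
  surjection \<open>\<gamma>\<^sub>n(E) \<rightarrow> \<gamma>\<^sub>n(G)\<close>.  A lift \<open>f'\<close> of \<open>f\<close> to \<open>E\<close> shows that \<open>\<delta>\<close> composed with
  the \<open>n\<close>-th tensor power of \<open>f\<close> is \<open>f' \<circ> \<lambda>\<^sub>n\<close>, where now \<open>\<lambda>\<^sub>n\<close> belongs to \<open>\<Gamma>\<close>; so \<open>\<delta>\<close> kills
  the images of the elements of \<open>ker \<lambda>\<^sub>n\<close> over \<open>\<Gamma>\<close>.  Thus the kernel of \<open>\<gamma>\<^sub>n(E) \<rightarrow> \<gamma>\<^sub>n(G)\<close> is a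
  quotient of \<open>M\<^sub>n(f)\<close> and belongs to the class, and then so does the extension \<open>\<gamma>\<^sub>n(E)\<close>
  (\<open>extension_of_image_in_class\<close>).

  The homomorphism \<open>\<delta>\<close> cannot be built stage by stage with values in \<open>E\<close>: for \<open>k < n\<close> a \<open>k\<close>-fold
  commutator is determined by the images of its entries only modulo \<open>Z\<^sub>n\<^sub>-\<^sub>k(E)\<close>.  It is replaced
  by a multivalued map: the subgroup \<open>R\<^sub>k\<close> of pairs \<open>(t, x)\<close> in the product of the \<open>k\<close>-th tensor power
  of \<open>G\<close> with \<open>E\<close> that is generated by the pairs \<open>(t \<otimes> p y, [x, y])\<close> with \<open>(t, x)\<close> in the preceding
  subgroup and \<open>y \<in> E\<close> (\<open>tensor_lifts\<close>).  It is the image of the \<open>k\<close>-th tensor power of \<open>E\<close>, and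
  its projections, its position over \<open>\<lambda>\<^sub>k\<close> and its naturality in \<open>f\<close> are checked on
  generators.  The hypothesis on \<open>A\<close> bounds the values over \<open>1\<close>: they lie in \<open>Z\<^sub>n\<^sub>-\<^sub>k(E)\<close>
  (\<open>tensor_lifts_of_one\<close>).  Indeed, if this holds for \<open>k\<close>, then commutators of values are well
  defined modulo \<open>Z\<^sub>n\<^sub>-\<^sub>k\<^sub>-\<^sub>1(E)\<close>, because \<open>\<gamma>\<^sub>k(E)\<close> and \<open>A\<close> commute modulo that term
  (\<open>lower_central_commutes_with_upper_central\<close>).  They form a crossed pairing
  (\<open>commutator_coset_pairing\<close>), which extends to a homomorphism on the next tensor power by its
  universal property, and the pairs in \<open>R\<^sub>k\<^sub>+\<^sub>1\<close>, taken modulo that term, lie in its graph.  For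
  \<open>k = n\<close> the bound is trivial and \<open>R\<^sub>n\<close> is the graph of \<open>\<delta>\<close>.

  For exterior powers the same argument works with the derived series and with pairs
  \<open>(a \<and> b, [x, y])\<close>.  The place of \<open>Z\<^sub>n\<^sub>-\<^sub>k(E)\<close> is taken by the elements of \<open>\<Gamma>\<^sub>k(E)\<close> killed by
  commutators with \<open>n - k\<close> successive terms of the derived series (\<open>annihilator_term\<close>).  The two
  constructions share the step \<open>lift_step\<close>.
\<close>

section \<open>Commutator calculus\<close>

context group
begin

lemma inv_mult_cancel:
  assumes "x \<in> carrier G" "y \<in> carrier G"
  shows "inv x \<otimes> (x \<otimes> y) = y" and "x \<otimes> (inv x \<otimes> y) = y"
  using assms by (simp_all flip: m_assoc)

text \<open>Rewriting with these rules brings every product of letters and inverses of letters to its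
  freely reduced form, so it proves all identities that hold in free groups.\<close>

lemmas free_reduction = m_assoc inv_mult_group inv_mult_cancel conjugate_def commutator_def

lemma conjugate_closed [simp]: "x \<in> carrier G \<Longrightarrow> y \<in> carrier G \<Longrightarrow> conjugate G x y \<in> carrier G"
  by (simp add: conjugate_def)

lemma commutator_closed [simp]: "x \<in> carrier G \<Longrightarrow> y \<in> carrier G \<Longrightarrow> commutator G x y \<in> carrier G"
  by (simp add: commutator_def)

lemma conjugate_hom: "g \<in> carrier G \<Longrightarrow> conjugate G g \<in> hom G G"
  by (rule homI) (simp_all add: free_reduction)

lemma conjugate_mult:
  "\<lbrakk>g \<in> carrier G; h \<in> carrier G; x \<in> carrier G\<rbrakk>
    \<Longrightarrow> conjugate G (g \<otimes> h) x = conjugate G g (conjugate G h x)"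
  by (simp add: free_reduction)

lemma commutator_mult_left:
  "\<lbrakk>x \<in> carrier G; x' \<in> carrier G; y \<in> carrier G\<rbrakk> \<Longrightarrow> commutator G (x \<otimes> x') y
    = commutator G (conjugate G x x') (conjugate G x y) \<otimes> commutator G x y"
  by (simp add: free_reduction)

lemma commutator_mult_right:
  "\<lbrakk>x \<in> carrier G; y \<in> carrier G; y' \<in> carrier G\<rbrakk> \<Longrightarrow> commutator G x (y \<otimes> y')
    = commutator G x y \<otimes> commutator G (conjugate G y x) (conjugate G y y')"
  by (simp add: free_reduction)

lemma conjugate_commutator:
  "\<lbrakk>g \<in> carrier G; x \<in> carrier G; y \<in> carrier G\<rbrakk> \<Longrightarrow>
    conjugate G g (commutator G x y) = commutator G (conjugate G g x) (conjugate G g y)"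
  by (simp add: free_reduction)

lemma commutator_self: "x \<in> carrier G \<Longrightarrow> commutator G x x = \<one>"
  by (simp add: free_reduction)

lemma commutator_flip:
  "\<lbrakk>x \<in> carrier G; y \<in> carrier G\<rbrakk> \<Longrightarrow> commutator G x y = inv (commutator G y x)"
  by (simp add: free_reduction)

lemma commutator_subgroup_subgroup:
  assumes "A \<subseteq> carrier G" "B \<subseteq> carrier G"
  shows "subgroup (commutator_subgroup G A B) G"
  unfolding commutator_subgroup_def
  using assms by (intro generate_is_subgroup) (auto simp: subset_iff)

lemma commutator_in_commutator_subgroup:
  "a \<in> A \<Longrightarrow> b \<in> B \<Longrightarrow> commutator G a b \<in> commutator_subgroup G A B"
  unfolding commutator_subgroup_def by (auto intro: generate.incl)

lemma commutator_subgroup_normal: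
  assumes "A \<lhd> G" "B \<lhd> G"
  shows "commutator_subgroup G A B \<lhd> G"
  unfolding commutator_subgroup_def
proof (rule normal_generateI)
  have AB: "A \<subseteq> carrier G" "B \<subseteq> carrier G"
    using assms by (auto dest!: normal_imp_subgroup subgroup.subset)
  then show "{commutator G a b | a b. a \<in> A \<and> b \<in> B} \<subseteq> carrier G"
    by (auto simp: subset_iff)
  fix h g
  assume "h \<in> {commutator G a b | a b. a \<in> A \<and> b \<in> B}" and g: "g \<in> carrier G"
  then obtain a b where ab: "h = commutator G a b" "a \<in> A" "b \<in> B" by blast
  have "g \<otimes> h \<otimes> inv g = commutator G (conjugate G g a) (conjugate G g b)"
    using ab AB g conjugate_commutator[of g a b] by (auto simp: conjugate_def)
  moreover have "conjugate G g a \<in> A" "conjugate G g b \<in> B"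
    using assms ab g by (simp_all add: conjugate_def normal.inv_op_closed2)
  ultimately show "g \<otimes> h \<otimes> inv g \<in> {commutator G a b | a b. a \<in> A \<and> b \<in> B}" by blast
qed

lemma normal_closure_subset: "S \<subseteq> normal_closure G S"
  by (auto simp: normal_closure_def)

lemma normal_closure_least: "N \<lhd> G \<Longrightarrow> S \<subseteq> N \<Longrightarrow> normal_closure G S \<subseteq> N"
  by (auto simp: normal_closure_def)

lemma normal_closure_normal:
  assumes "S \<subseteq> carrier G"
  shows "normal_closure G S \<lhd> G"
proof -
  have "subgroup (normal_closure G S) G"
    unfolding normal_closure_def
    using assms normal_self by (intro subgroups_Inter) (auto dest: normal_imp_subgroup)
  then show ?thesis
    unfolding normal_inv_iff
    by (auto simp: normal_closure_def intro: normal.inv_op_closed2)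
qed

end

lemma (in group_hom) hom_conjugate:
  "x \<in> carrier G \<Longrightarrow> y \<in> carrier G \<Longrightarrow> h (conjugate G x y) = conjugate H (h x) (h y)"
  by (simp add: conjugate_def)

lemma (in group_hom) hom_commutator:
  "x \<in> carrier G \<Longrightarrow> y \<in> carrier G \<Longrightarrow> h (commutator G x y) = commutator H (h x) (h y)"
  by (simp add: commutator_def)

lemma (in group_hom) commutator_subgroup_img:
  assumes "A \<subseteq> carrier G" "B \<subseteq> carrier G"
  shows "h ` commutator_subgroup G A B = commutator_subgroup H (h ` A) (h ` B)"
proof -
  have "h ` {commutator G a b | a b. a \<in> A \<and> b \<in> B}
      = {commutator H a b | a b. a \<in> h ` A \<and> b \<in> h ` B}"
    using assms
    by (auto simp: image_iff subset_iff hom_commutator[symmetric]) (metis hom_commutator)+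
  moreover have "{commutator G a b | a b. a \<in> A \<and> b \<in> B} \<subseteq> carrier G"
    using assms by (auto simp: subset_iff)
  note generate_img[OF this]
  ultimately show ?thesis
    unfolding commutator_subgroup_def by simp
qed

lemma (in group_hom) subgroup_vimage:
  assumes "subgroup B H"
  shows "subgroup {x \<in> carrier G. h x \<in> B} G"
proof (rule G.subgroupI)
  show "{x \<in> carrier G. h x \<in> B} \<noteq> {}"
    using subgroup.one_closed[OF assms] by auto
qed (use assms in \<open>auto simp: subgroup.m_closed subgroup.m_inv_closed\<close>)

lemma group_homI: "group G \<Longrightarrow> group H \<Longrightarrow> h \<in> hom G H \<Longrightarrow> group_hom G H h"
  by (simp add: group_hom_def group_hom_axioms_def)

lemma hom_agree_on_generate:
  assumes "group G" "group H" "h \<in> hom G H" "k \<in> hom G H" "S \<subseteq> carrier G"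
    and agree: "\<And>s. s \<in> S \<Longrightarrow> h s = k s" and "x \<in> generate G S"
  shows "h x = k x"
proof -
  interpret h: group_hom G H h using assms by (intro group_homI)
  interpret k: group_hom G H k using assms by (intro group_homI)
  have sub: "y \<in> generate G S \<Longrightarrow> y \<in> carrier G" for y
    using h.G.generate_in_carrier assms(5) by blast
  from assms(7) show ?thesis
    by induction (use agree sub assms(5) in \<open>auto simp: subset_iff\<close>)
qed


section \<open>Presented groups\<close>

text \<open>Words are described by their letters only through \<open>lists\<close>, since the hypotheses of \<open>word_cong\<close>
  have this form; the rules removed here would rewrite them to statements about sets of letters.\<close>

declare in_lists_conv_set [simp del] in_listsD [rule del] in_listsI [rule del]

lemma word_cong_lists:
  "(u, v) \<in> word_cong Y R \<Longrightarrow> u \<in> lists (Y \<times> UNIV) \<and> v \<in> lists (Y \<times> UNIV)"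
  by (induction rule: word_cong.induct) auto

lemma equiv_word_cong: "equiv (lists (Y \<times> UNIV)) (word_cong Y R)"
proof (rule equivI)
  show "word_cong Y R \<subseteq> lists (Y \<times> UNIV) \<times> lists (Y \<times> UNIV)"
    by (auto dest: word_cong_lists)
  show "refl_on (lists (Y \<times> UNIV)) (word_cong Y R)"
    by (rule refl_onI) (rule word_cong.refl)
qed (auto intro: symI transI word_cong.sym word_cong.trans)

context
  fixes Y :: "'x set" and R :: "('x word \<times> 'x word) set"
begin

abbreviation word_class :: "'x word \<Rightarrow> 'x word set" where
  "word_class u \<equiv> word_cong Y R `` {u}"

lemma word_class_eq:
  "u \<in> lists (Y \<times> UNIV) \<Longrightarrow> v \<in> lists (Y \<times> UNIV) \<Longrightarrow>
    word_class u = word_class v \<longleftrightarrow> (u, v) \<in> word_cong Y R"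
  by (rule eq_equiv_class_iff[OF equiv_word_cong])

lemma carrier_presented_group:
  "carrier (presented_group Y R) = word_class ` lists (Y \<times> UNIV)"
  by (auto simp: presented_group_def quotient_def)

lemma one_presented_group: "\<one>\<^bsub>presented_group Y R\<^esub> = word_class []"
  by (simp add: presented_group_def)

lemma mult_presented_group:
  assumes "u \<in> lists (Y \<times> UNIV)" "v \<in> lists (Y \<times> UNIV)"
  shows "word_class u \<otimes>\<^bsub>presented_group Y R\<^esub> word_class v = word_class (u @ v)"
proof -
  have "congruent2 (word_cong Y R) (word_cong Y R) (\<lambda>u v. word_class (u @ v))"
    by (rule congruent2I') (metis equiv_class_eq[OF equiv_word_cong] word_cong.append)
  then show ?thesis
    using UN_equiv_class2[OF equiv_word_cong equiv_word_cong _ assms]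
    by (simp add: presented_group_def)
qed

lemma word_class_in_presented_group:
  "u \<in> lists (Y \<times> UNIV) \<Longrightarrow> word_class u \<in> carrier (presented_group Y R)"
  by (auto simp: carrier_presented_group)

lemma word_inverse:
  "w \<in> lists (Y \<times> UNIV) \<Longrightarrow> \<exists>w' \<in> lists (Y \<times> UNIV). (w' @ w, []) \<in> word_cong Y R"
proof (induction w rule: rev_induct)
  case Nil
  then show ?case by (intro bexI[of _ "[]"]) (auto intro: word_cong.refl)
next
  case (snoc l w)
  obtain x b where l: "l = (x, b)" "x \<in> Y" using snoc.prems by auto
  obtain w' where w': "w' \<in> lists (Y \<times> UNIV)" "(w' @ w, []) \<in> word_cong Y R"
    using snoc by auto
  let ?l = "[(x, \<not> b)]" and ?r = "[(x, b)]"
  have "((?l @ (w' @ w)) @ ?r, (?l @ []) @ ?r) \<in> word_cong Y R"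
    using w' l by (intro word_cong.append word_cong.refl) auto
  moreover have "(?l @ ?r, []) \<in> word_cong Y R"
    using word_cong.cancel[OF l(2), of "\<not> b"] by simp
  ultimately have "((?l @ w') @ w @ [l], []) \<in> word_cong Y R"
    using l word_cong.trans by fastforce
  then show ?case using w' l by (intro bexI[of _ "?l @ w'"]) auto
qed

lemma group_presented_group: "group (presented_group Y R)"
proof (rule groupI)
  fix A B C
  assume "A \<in> carrier (presented_group Y R)" "B \<in> carrier (presented_group Y R)"
    "C \<in> carrier (presented_group Y R)"
  then obtain u v w where "A = word_class u" "B = word_class v" "C = word_class w"
    "u \<in> lists (Y \<times> UNIV)" "v \<in> lists (Y \<times> UNIV)" "w \<in> lists (Y \<times> UNIV)"
    unfolding carrier_presented_group by blast
  then show "A \<otimes>\<^bsub>presented_group Y R\<^esub> B \<otimes>\<^bsub>presented_group Y R\<^esub> C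
      = A \<otimes>\<^bsub>presented_group Y R\<^esub> (B \<otimes>\<^bsub>presented_group Y R\<^esub> C)"
    by (simp add: mult_presented_group)
next
  fix A
  assume "A \<in> carrier (presented_group Y R)"
  then obtain w where w: "A = word_class w" "w \<in> lists (Y \<times> UNIV)"
    unfolding carrier_presented_group by blast
  then obtain w' where "w' \<in> lists (Y \<times> UNIV)" "(w' @ w, []) \<in> word_cong Y R"
    using word_inverse by blast
  then show "\<exists>B \<in> carrier (presented_group Y R). B \<otimes>\<^bsub>presented_group Y R\<^esub> A
      = \<one>\<^bsub>presented_group Y R\<^esub>"
    using w by (intro bexI[of _ "word_class w'"])
      (auto simp: mult_presented_group one_presented_group word_class_eq carrier_presented_group)
qed (auto simp: carrier_presented_group one_presented_group mult_presented_group)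

lemma generate_presented_group:
  "carrier (presented_group Y R)
    = generate (presented_group Y R) ((\<lambda>y. word_class [(y, True)]) ` Y)"
    (is "_ = generate ?X ?S")
proof
  interpret X: group ?X by (rule group_presented_group)
  have S: "?S \<subseteq> carrier ?X" by (auto simp: carrier_presented_group)
  then show "generate ?X ?S \<subseteq> carrier ?X" by (rule X.generate_incl)
  \<comment> \<open>Negative letters represent inverses of generators, so each word is a product of generators and their inverses.\<close>
  have inv: "word_class [(y, False)] = inv\<^bsub>?X\<^esub> word_class [(y, True)]" if "y \<in> Y" for y
  proof (rule X.inv_equality[symmetric])
    show "word_class [(y, False)] \<otimes>\<^bsub>?X\<^esub> word_class [(y, True)] = \<one>\<^bsub>?X\<^esub>"
      using that word_cong.cancel[of y Y False R]
      by (simp add: mult_presented_group one_presented_group word_class_eq)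
  qed (use that in \<open>auto simp: carrier_presented_group\<close>)
  have "word_class w \<in> generate ?X ?S" if "w \<in> lists (Y \<times> UNIV)" for w
    using that
  proof (induction w)
    case Nil
    then show ?case using generate.one[of ?X ?S] by (simp add: one_presented_group)
  next
    case (Cons l w)
    obtain y b where l: "l = (y, b)" "y \<in> Y" using Cons.hyps by auto
    have "word_class [l] \<in> generate ?X ?S"
      using l inv by (cases b) (auto intro: generate.incl generate.inv)
    then have "word_class [l] \<otimes>\<^bsub>?X\<^esub> word_class w \<in> generate ?X ?S"
      using Cons by (auto intro: generate.eng)
    then show ?case using l Cons.hyps by (simp add: mult_presented_group)
  qed
  then show "carrier ?X \<subseteq> generate ?X ?S" by (auto simp: carrier_presented_group)
qed

end

lemma (in group) word_eval_closed:
  "\<phi> ` Y \<subseteq> carrier G \<Longrightarrow> w \<in> lists (Y \<times> UNIV) \<Longrightarrow> word_eval G \<phi> w \<in> carrier G"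
  by (induction w) auto

lemma (in group) word_eval_append:
  assumes "\<phi> ` Y \<subseteq> carrier G" "u \<in> lists (Y \<times> UNIV)" "v \<in> lists (Y \<times> UNIV)"
  shows "word_eval G \<phi> (u @ v) = word_eval G \<phi> u \<otimes> word_eval G \<phi> v"
  using assms(2)
  by (induction u)
     (use assms in \<open>auto simp: m_assoc image_subset_iff word_eval_closed[OF assms(1)]\<close>)

context group
begin

context
  fixes Y :: "'x set" and R :: "('x word \<times> 'x word) set" and \<phi> :: "'x \<Rightarrow> 'a"
  assumes \<phi>_closed: "\<phi> ` Y \<subseteq> carrier G"
    and \<phi>_relations: "\<And>u v. \<lbrakk>(u, v) \<in> R; u \<in> lists (Y \<times> UNIV); v \<in> lists (Y \<times> UNIV)\<rbrakk>
      \<Longrightarrow> word_eval G \<phi> u = word_eval G \<phi> v"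
begin

lemma word_eval_cong: "(u, v) \<in> word_cong Y R \<Longrightarrow> word_eval G \<phi> u = word_eval G \<phi> v"
proof (induction rule: word_cong.induct)
  case (append u u' v v')
  then show ?case by (metis word_cong_lists word_eval_append \<phi>_closed)
next
  case (cancel x b)
  then show ?case using \<phi>_closed by (auto simp: inv_mult_cancel)
qed (use \<phi>_relations in auto)

lemma presented_lift_class:
  assumes "w \<in> lists (Y \<times> UNIV)"
  shows "presented_lift G \<phi> (word_class Y R w) = word_eval G \<phi> w"
proof -
  have "word_eval G \<phi> ` word_class Y R w = {word_eval G \<phi> w}"
    using word_eval_cong assms by (auto intro!: image_eqI[of _ _ w] word_cong.refl)
  then show ?thesis by (simp add: presented_lift_def)
qed

lemma presented_lift_hom: "presented_lift G \<phi> \<in> hom (presented_group Y R) G"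
  by (rule homI)
     (auto simp: carrier_presented_group mult_presented_group presented_lift_class
       word_eval_append[OF \<phi>_closed] word_eval_closed[OF \<phi>_closed])

lemma presented_lift_generator:
  "y \<in> Y \<Longrightarrow> presented_lift G \<phi> (word_class Y R [(y, True)]) = \<phi> y"
  using \<phi>_closed by (auto simp: presented_lift_class)

end

end


section \<open>Crossed pairings and tensor products\<close>

text \<open>The two laws are those of the symbols \<open>m \<otimes> x\<close>, so crossed pairings into \<open>H\<close> correspond to
  homomorphisms from the tensor product to \<open>H\<close>.\<close>

definition crossed_pairing ::
  "('m, 'y) monoid_scheme \<Rightarrow> ('n, 'z) monoid_scheme \<Rightarrow> ('m \<Rightarrow> 'n \<Rightarrow> 'n) \<Rightarrow> ('n \<Rightarrow> 'm \<Rightarrow> 'm) \<Rightarrow>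
   ('h, 'w) monoid_scheme \<Rightarrow> ('m \<times> 'n \<Rightarrow> 'h) \<Rightarrow> bool" where
  "crossed_pairing M N a b H \<phi> \<longleftrightarrow>
     (\<forall>m \<in> carrier M. \<forall>x \<in> carrier N. \<phi> (m, x) \<in> carrier H)
   \<and> (\<forall>m \<in> carrier M. \<forall>m' \<in> carrier M. \<forall>x \<in> carrier N.
        \<phi> (m \<otimes>\<^bsub>M\<^esub> m', x) = \<phi> (conjugate M m m', a m x) \<otimes>\<^bsub>H\<^esub> \<phi> (m, x))
   \<and> (\<forall>m \<in> carrier M. \<forall>x \<in> carrier N. \<forall>x' \<in> carrier N.
        \<phi> (m, x \<otimes>\<^bsub>N\<^esub> x') = \<phi> (m, x) \<otimes>\<^bsub>H\<^esub> \<phi> (b x m, conjugate N x x'))"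

lemma crossed_pairingI:
  assumes "\<And>m x. \<lbrakk>m \<in> carrier M; x \<in> carrier N\<rbrakk> \<Longrightarrow> \<phi> (m, x) \<in> carrier H"
    and "\<And>m m' x. \<lbrakk>m \<in> carrier M; m' \<in> carrier M; x \<in> carrier N\<rbrakk> \<Longrightarrow>
      \<phi> (m \<otimes>\<^bsub>M\<^esub> m', x) = \<phi> (conjugate M m m', a m x) \<otimes>\<^bsub>H\<^esub> \<phi> (m, x)"
    and "\<And>m x x'. \<lbrakk>m \<in> carrier M; x \<in> carrier N; x' \<in> carrier N\<rbrakk> \<Longrightarrow>
      \<phi> (m, x \<otimes>\<^bsub>N\<^esub> x') = \<phi> (m, x) \<otimes>\<^bsub>H\<^esub> \<phi> (b x m, conjugate N x x')"
  shows "crossed_pairing M N a b H \<phi>"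
  using assms by (simp add: crossed_pairing_def)

lemma crossed_pairingD:
  assumes "crossed_pairing M N a b H \<phi>"
  shows "\<lbrakk>m \<in> carrier M; x \<in> carrier N\<rbrakk> \<Longrightarrow> \<phi> (m, x) \<in> carrier H"
    and "\<lbrakk>m \<in> carrier M; m' \<in> carrier M; x \<in> carrier N\<rbrakk> \<Longrightarrow>
      \<phi> (m \<otimes>\<^bsub>M\<^esub> m', x) = \<phi> (conjugate M m m', a m x) \<otimes>\<^bsub>H\<^esub> \<phi> (m, x)"
    and "\<lbrakk>m \<in> carrier M; x \<in> carrier N; x' \<in> carrier N\<rbrakk> \<Longrightarrow>
      \<phi> (m, x \<otimes>\<^bsub>N\<^esub> x') = \<phi> (m, x) \<otimes>\<^bsub>H\<^esub> \<phi> (b x m, conjugate N x x')"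
  using assms by (simp_all add: crossed_pairing_def)

text \<open>Together with \<open>crossed_pairing_commutator\<close> and the universal symbol, this yields the pairings that
  define the maps \<open>\<lambda>\<close>, the diagonal action and the functoriality of tensor powers.\<close>

lemma crossed_pairing_pullback:
  assumes \<phi>: "crossed_pairing M N a b H \<phi>"
    and \<alpha>: "group_hom M' M \<alpha>" and \<beta>: "group_hom N' N \<beta>"
    and a': "\<And>m x. \<lbrakk>m \<in> carrier M'; x \<in> carrier N'\<rbrakk> \<Longrightarrow> \<beta> (a' m x) = a (\<alpha> m) (\<beta> x)"
    and b': "\<And>m x. \<lbrakk>m \<in> carrier M'; x \<in> carrier N'\<rbrakk> \<Longrightarrow> \<alpha> (b' x m) = b (\<beta> x) (\<alpha> m)"
  shows "crossed_pairing M' N' a' b' H (\<lambda>(m, x). \<phi> (\<alpha> m, \<beta> x))"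
proof -
  interpret \<alpha>: group_hom M' M \<alpha> by (rule \<alpha>)
  interpret \<beta>: group_hom N' N \<beta> by (rule \<beta>)
  show ?thesis
    by (rule crossed_pairingI)
       (simp_all add: crossed_pairingD[OF \<phi>] a' b' \<alpha>.hom_conjugate \<beta>.hom_conjugate)
qed

lemma crossed_pairing_compose_hom:
  assumes \<phi>: "crossed_pairing M N a b H \<phi>" and h: "h \<in> hom H K"
    and "group M" "group N"
    and a: "\<And>m x. \<lbrakk>m \<in> carrier M; x \<in> carrier N\<rbrakk> \<Longrightarrow> a m x \<in> carrier N"
    and b: "\<And>m x. \<lbrakk>m \<in> carrier M; x \<in> carrier N\<rbrakk> \<Longrightarrow> b x m \<in> carrier M"
  shows "crossed_pairing M N a b K (\<lambda>z. h (\<phi> z))"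
  using assms(3,4)
  by (intro crossed_pairingI)
     (simp_all add: crossed_pairingD[OF \<phi>] a b group.conjugate_closed hom_in_carrier[OF h]
       hom_mult[OF h])

lemma (in group) crossed_pairing_commutator:
  "crossed_pairing G G (conjugate G) (conjugate G) G (\<lambda>(x, y). commutator G x y)"
  by (rule crossed_pairingI) (simp_all add: commutator_mult_left commutator_mult_right)

context
  fixes M :: "('m, 'y) monoid_scheme" and N :: "('n, 'z) monoid_scheme"
    and a :: "'m \<Rightarrow> 'n \<Rightarrow> 'n" and b :: "'n \<Rightarrow> 'm \<Rightarrow> 'm"
begin

lemma group_tensor_product: "group (tensor_product M N a b)"
  by (simp add: tensor_product_def group_presented_group)

lemma tensor_symbol_closed:
  "m \<in> carrier M \<Longrightarrow> x \<in> carrier N \<Longrightarrow> tensor_symbol M N a b m x \<in> carrier (tensor_product M N a b)"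
  by (simp add: tensor_product_def tensor_symbol_def word_class_in_presented_group)

lemma generate_tensor_product:
  "carrier (tensor_product M N a b) = generate (tensor_product M N a b)
    {tensor_symbol M N a b m x | m x. m \<in> carrier M \<and> x \<in> carrier N}"
proof -
  have "(\<lambda>y. word_class (carrier M \<times> carrier N) (tensor_relations M N a b) [(y, True)])
      ` (carrier M \<times> carrier N)
    = {tensor_symbol M N a b m x | m x. m \<in> carrier M \<and> x \<in> carrier N}"
    by (auto simp: tensor_symbol_def)
  then show ?thesis
    using generate_presented_group[of "carrier M \<times> carrier N" "tensor_relations M N a b"]
    by (simp add: tensor_product_def)
qed

lemma tensor_lift:
  assumes H: "group H" and \<phi>: "crossed_pairing M N a b H \<phi>"
  shows "presented_lift H \<phi> \<in> hom (tensor_product M N a b) H"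
    and "\<lbrakk>m \<in> carrier M; x \<in> carrier N\<rbrakk> \<Longrightarrow> presented_lift H \<phi> (tensor_symbol M N a b m x) = \<phi> (m, x)"
proof -
  interpret H: group H by (rule H)
  have closed: "\<phi> ` (carrier M \<times> carrier N) \<subseteq> carrier H"
    using crossed_pairingD(1)[OF \<phi>] by auto
  have rel: "word_eval H \<phi> u = word_eval H \<phi> v"
    if "(u, v) \<in> tensor_relations M N a b" "u \<in> lists ((carrier M \<times> carrier N) \<times> UNIV)"
      "v \<in> lists ((carrier M \<times> carrier N) \<times> UNIV)" for u v
    using that crossed_pairingD[OF \<phi>] by (auto simp: tensor_relations_def)
  show "presented_lift H \<phi> \<in> hom (tensor_product M N a b) H"
    unfolding tensor_product_def by (rule H.presented_lift_hom[OF closed rel])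
  show "presented_lift H \<phi> (tensor_symbol M N a b m x) = \<phi> (m, x)"
    if "m \<in> carrier M" "x \<in> carrier N"
    unfolding tensor_symbol_def
    by (rule H.presented_lift_generator[OF closed rel]) (use that in auto)
qed

lemma crossed_pairing_tensor_symbol:
  assumes "group M" "group N"
    and a: "\<And>m x. \<lbrakk>m \<in> carrier M; x \<in> carrier N\<rbrakk> \<Longrightarrow> a m x \<in> carrier N"
    and b: "\<And>m x. \<lbrakk>m \<in> carrier M; x \<in> carrier N\<rbrakk> \<Longrightarrow> b x m \<in> carrier M"
  shows "crossed_pairing M N a b (tensor_product M N a b) (\<lambda>(m, x). tensor_symbol M N a b m x)"
proof -
  interpret M: group M by (rule assms)
  interpret N: group N by (rule assms)
  let ?Y = "carrier M \<times> carrier N" and ?R = "tensor_relations M N a b"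
  have eq: "word_class ?Y ?R u = word_class ?Y ?R v"
    if "(u, v) \<in> ?R" "u \<in> lists (?Y \<times> UNIV)" "v \<in> lists (?Y \<times> UNIV)" for u v
    using that by (simp add: word_class_eq word_cong.relation)
  show ?thesis
  proof (rule crossed_pairingI)
    fix m m' x assume *: "m \<in> carrier M" "m' \<in> carrier M" "x \<in> carrier N"
    \<comment> \<open>Closure under the actions makes both sides words over the generators, as a relation must be to take effect.\<close>
    have "word_class ?Y ?R [((m \<otimes>\<^bsub>M\<^esub> m', x), True)]
        = word_class ?Y ?R [((conjugate M m m', a m x), True), ((m, x), True)]"
      by (rule eq) (use * a in \<open>auto simp: tensor_relations_def\<close>)
    then show "(\<lambda>(m, x). tensor_symbol M N a b m x) (m \<otimes>\<^bsub>M\<^esub> m', x)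
      = (\<lambda>(m, x). tensor_symbol M N a b m x) (conjugate M m m', a m x)
        \<otimes>\<^bsub>tensor_product M N a b\<^esub> (\<lambda>(m, x). tensor_symbol M N a b m x) (m, x)"
      using * a by (simp add: tensor_symbol_def tensor_product_def mult_presented_group)
  next
    fix m x x' assume *: "m \<in> carrier M" "x \<in> carrier N" "x' \<in> carrier N"
    have "word_class ?Y ?R [((m, x \<otimes>\<^bsub>N\<^esub> x'), True)]
        = word_class ?Y ?R [((m, x), True), ((b x m, conjugate N x x'), True)]"
      by (rule eq) (use * b in \<open>auto simp: tensor_relations_def\<close>)
    then show "(\<lambda>(m, x). tensor_symbol M N a b m x) (m, x \<otimes>\<^bsub>N\<^esub> x')
      = (\<lambda>(m, x). tensor_symbol M N a b m x) (m, x)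
        \<otimes>\<^bsub>tensor_product M N a b\<^esub> (\<lambda>(m, x). tensor_symbol M N a b m x) (b x m, conjugate N x x')"
      using * b by (simp add: tensor_symbol_def tensor_product_def mult_presented_group)
  qed (simp add: tensor_symbol_closed)
qed

end


section \<open>Exterior squares\<close>

definition alternating_pairing ::
  "('m, 'y) monoid_scheme \<Rightarrow> ('h, 'w) monoid_scheme \<Rightarrow> ('m \<times> 'm \<Rightarrow> 'h) \<Rightarrow> bool" where
  "alternating_pairing M H \<phi> \<longleftrightarrow> crossed_pairing M M (conjugate M) (conjugate M) H \<phi>
    \<and> (\<forall>m \<in> carrier M. \<phi> (m, m) = \<one>\<^bsub>H\<^esub>)"

lemma alternating_pairingD:
  assumes "alternating_pairing M H \<phi>"
  shows "crossed_pairing M M (conjugate M) (conjugate M) H \<phi>"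
    and "m \<in> carrier M \<Longrightarrow> \<phi> (m, m) = \<one>\<^bsub>H\<^esub>"
  using assms by (simp_all add: alternating_pairing_def)

lemma (in group) alternating_pairing_commutator:
  "alternating_pairing G G (\<lambda>(x, y). commutator G x y)"
  by (simp add: alternating_pairing_def crossed_pairing_commutator commutator_self)

lemma alternating_pairing_pullback:
  assumes \<phi>: "alternating_pairing M H \<phi>" and \<alpha>: "group_hom M' M \<alpha>"
  shows "alternating_pairing M' H (\<lambda>(a, b). \<phi> (\<alpha> a, \<alpha> b))"
proof -
  interpret \<alpha>: group_hom M' M \<alpha> by (rule \<alpha>)
  show ?thesis
    using crossed_pairing_pullback[OF alternating_pairingD(1)[OF \<phi>] \<alpha> \<alpha>]
      alternating_pairingD(2)[OF \<phi>]
    by (simp add: alternating_pairing_def \<alpha>.hom_conjugate)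
qed

context group
begin

lemma tensor_square_facts:
  shows group_tensor_square: "group (tensor_square G)"
    and square_symbol_closed:
      "m \<in> carrier G \<Longrightarrow> x \<in> carrier G \<Longrightarrow> square_symbol G m x \<in> carrier (tensor_square G)"
    and crossed_pairing_square_symbol: "crossed_pairing G G (conjugate G) (conjugate G)
      (tensor_square G) (\<lambda>(m, x). square_symbol G m x)"
    and generate_tensor_square: "carrier (tensor_square G) = generate (tensor_square G)
      {square_symbol G m x | m x. m \<in> carrier G \<and> x \<in> carrier G}"
  unfolding tensor_square_def square_symbol_def
  by (simp_all add: group_tensor_product tensor_symbol_closed crossed_pairing_tensor_symbol
      flip: generate_tensor_product)

lemma exterior_kernel_normal: "exterior_kernel G \<lhd> tensor_square G"
  unfolding exterior_kernel_def
  by (rule group.normal_closure_normal[OF group_tensor_square]) (auto simp: square_symbol_closed)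

lemma group_exterior_square: "group (exterior_square G)"
  unfolding exterior_square_def by (rule normal.factorgroup_is_group[OF exterior_kernel_normal])

lemma exterior_projection_hom:
  "(\<lambda>t. exterior_kernel G #>\<^bsub>tensor_square G\<^esub> t) \<in> hom (tensor_square G) (exterior_square G)"
  unfolding exterior_square_def by (rule normal.r_coset_hom_Mod[OF exterior_kernel_normal])

lemma wedge_symbol_closed:
  "a \<in> carrier G \<Longrightarrow> b \<in> carrier G \<Longrightarrow> wedge_symbol G a b \<in> carrier (exterior_square G)"
  unfolding wedge_symbol_def
  by (rule hom_in_carrier[OF exterior_projection_hom square_symbol_closed])

lemma crossed_pairing_wedge_symbol:
  "crossed_pairing G G (conjugate G) (conjugate G) (exterior_square G) (\<lambda>(a, b). wedge_symbol G a b)"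
  using crossed_pairing_compose_hom[OF crossed_pairing_square_symbol exterior_projection_hom
      is_group is_group]
  by (simp add: wedge_symbol_def case_prod_unfold)

lemma wedge_symbol_self:
  assumes "a \<in> carrier G"
  shows "wedge_symbol G a a = \<one>\<^bsub>exterior_square G\<^esub>"
proof -
  have "square_symbol G a a \<in> exterior_kernel G"
    using assms group.normal_closure_subset[OF group_tensor_square]
    by (fastforce simp: exterior_kernel_def)
  then show ?thesis
    using group.coset_join2[OF group_tensor_square square_symbol_closed
        normal_imp_subgroup[OF exterior_kernel_normal]] assms
    by (simp add: wedge_symbol_def exterior_square_def)
qed

lemma generate_exterior_square:
  "carrier (exterior_square G) = generate (exterior_square G)
    {wedge_symbol G a b | a b. a \<in> carrier G \<and> b \<in> carrier G}"
proof -
  interpret \<pi>: group_hom "tensor_square G" "exterior_square G"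
      "\<lambda>t. exterior_kernel G #>\<^bsub>tensor_square G\<^esub> t"
    by (rule group_homI[OF group_tensor_square group_exterior_square exterior_projection_hom])
  have "{wedge_symbol G a b | a b. a \<in> carrier G \<and> b \<in> carrier G}
    = (\<lambda>t. exterior_kernel G #>\<^bsub>tensor_square G\<^esub> t)
      ` {square_symbol G m x | m x. m \<in> carrier G \<and> x \<in> carrier G}"
    by (auto simp: wedge_symbol_def)
  moreover have "{square_symbol G m x | m x. m \<in> carrier G \<and> x \<in> carrier G}
      \<subseteq> carrier (tensor_square G)"
    by (auto simp: square_symbol_closed)
  ultimately show ?thesis
    using \<pi>.generate_img
    by (simp add: carrier_FactGroup exterior_square_def flip: generate_tensor_square)
qed

lemma exterior_lift:
  assumes H: "group H" and "alternating_pairing G H \<phi>"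
  shows "exterior_lift H \<phi> \<in> hom (exterior_square G) H"
    and "\<lbrakk>a \<in> carrier G; b \<in> carrier G\<rbrakk> \<Longrightarrow> exterior_lift H \<phi> (wedge_symbol G a b) = \<phi> (a, b)"
proof -
  note \<phi> = alternating_pairingD(1)[OF assms(2)] and alternating = alternating_pairingD(2)[OF assms(2)]
  let ?T = "tensor_square G" and ?K = "exterior_kernel G"
  interpret l: group_hom ?T H "presented_lift H \<phi>"
    using group_homI[OF group_tensor_square H] tensor_lift(1)[OF H \<phi>] by (simp add: tensor_square_def)
  have symbol: "presented_lift H \<phi> (square_symbol G a b) = \<phi> (a, b)"
    if "a \<in> carrier G" "b \<in> carrier G" for a b
    using tensor_lift(2)[OF H \<phi>] that by (simp add: square_symbol_def)
  have "?K \<subseteq> kernel ?T H (presented_lift H \<phi>)"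
    unfolding exterior_kernel_def
    by (rule l.G.normal_closure_least[OF l.normal_kernel])
       (auto simp: kernel_def square_symbol_closed symbol alternating)
  then have coset: "exterior_lift H \<phi> (?K #>\<^bsub>?T\<^esub> t) = presented_lift H \<phi> t" if "t \<in> carrier ?T" for t
  proof -
    have "presented_lift H \<phi> ` (?K #>\<^bsub>?T\<^esub> t) = {presented_lift H \<phi> t}"
      using \<open>?K \<subseteq> _\<close> that l.G.rcos_self[OF that normal_imp_subgroup[OF exterior_kernel_normal]]
      by (auto simp: r_coset_def kernel_def)
    then show ?thesis by (simp add: exterior_lift_def)
  qed
  \<comment> \<open>The lift from the tensor square kills the diagonal symbols, so it is constant on cosets of the exterior kernel.\<close>
  show "exterior_lift H \<phi> \<in> hom (exterior_square G) H"
    by (rule homI)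
       (auto simp: exterior_square_def carrier_FactGroup coset
         normal.rcos_sum[OF exterior_kernel_normal])
  show "exterior_lift H \<phi> (wedge_symbol G a b) = \<phi> (a, b)"
    if "a \<in> carrier G" "b \<in> carrier G"
    using that by (simp add: wedge_symbol_def coset square_symbol_closed symbol)
qed

end


section \<open>Encoding elements of presented groups by words\<close>

lemma group_image_group:
  assumes "group G" "inj_on f (carrier G)"
  shows "group (image_group f G)"
  using group.iso_imp_img_group[OF assms(1) inj_imp_image_group_iso[OF assms(2)]]
  by (simp add: image_group_def)

lemma image_group_decode:
  assumes "group G" "inj_on f (carrier G)"
  shows "inv_into (carrier G) f \<in> hom (image_group f G) G"
  using group.iso_set_sym[OF assms(1) inj_imp_image_group_iso[OF assms(2)]] by (simp add: iso_def)

lemma image_group_encode: "inj_on f (carrier G) \<Longrightarrow> f \<in> hom G (image_group f G)"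
  using inj_imp_image_group_iso by (auto simp: iso_def)

lemma generate_image_group:
  assumes "group G" "inj_on f (carrier G)" and gen: "carrier G = generate G S" and S: "S \<subseteq> carrier G"
  shows "carrier (image_group f G) = generate (image_group f G) (f ` S)"
proof -
  interpret group_hom G "image_group f G" f
    by (rule group_homI[OF assms(1) group_image_group[OF assms(1,2)] image_group_encode[OF assms(2)]])
  show ?thesis using generate_img[OF S] gen by (simp add: image_group_carrier)
qed

lemma presented_group_elements:
  assumes "A \<in> carrier (presented_group Y R)"
  shows "A \<noteq> {}"
    and "\<lbrakk>B \<in> carrier (presented_group Y R); w \<in> A; w \<in> B\<rbrakk> \<Longrightarrow> A = B"
proof -
  show "A \<noteq> {}"
    using assms in_quotient_imp_non_empty[OF equiv_word_cong] by (simp add: presented_group_def)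
  show "A = B" if "B \<in> carrier (presented_group Y R)" "w \<in> A" "w \<in> B"
    using that assms quotient_disj[OF equiv_word_cong, of A Y R B]
    by (auto simp: presented_group_def)
qed

text \<open>Distinct classes of words are disjoint and not empty, so a class is recovered from any word in it.\<close>

lemma inj_on_tensor_code: "inj_on tensor_code (carrier (tensor_product M N a b))"
proof (rule inj_onI)
  fix A B
  assume AB: "A \<in> carrier (tensor_product M N a b)" "B \<in> carrier (tensor_product M N a b)"
    and "tensor_code A = tensor_code B"
  then have "(SOME w. w \<in> A) = (SOME w. w \<in> B)" by (simp add: tensor_code_def)
  moreover have "(SOME w. w \<in> A) \<in> A" "(SOME w. w \<in> B) \<in> B"
    using AB presented_group_elements(1) by (auto simp: tensor_product_def some_in_eq)
  ultimately show "A = B"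
    using AB presented_group_elements(2) unfolding tensor_product_def by metis
qed

text \<open>A word determines its class, and the class determines the coset that contains it.\<close>

lemma inj_on_wedge_code:
  fixes E :: "'e wedge_elt monoid"
  assumes "group E"
  shows "inj_on wedge_code (carrier (exterior_square E))"
proof (rule inj_onI)
  interpret E: group E by (rule assms)
  let ?T = "tensor_square E" and ?K = "exterior_kernel E"
  interpret K: normal ?K ?T by (rule E.exterior_kernel_normal)
  fix C D
  assume CD: "C \<in> carrier (exterior_square E)" "D \<in> carrier (exterior_square E)"
    and eq: "wedge_code C = wedge_code D"
  obtain c d where cd: "c \<in> carrier ?T" "C = ?K #>\<^bsub>?T\<^esub> c" "d \<in> carrier ?T" "D = ?K #>\<^bsub>?T\<^esub> d"
    using CD by (auto simp: exterior_square_def carrier_FactGroup)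
  have in_T: "A \<in> carrier (presented_group (carrier E \<times> carrier E)
      (tensor_relations E E (conjugate E) (conjugate E)))" if "A \<in> C \<union> D" for A
    using that cd K.r_coset_subset_G[OF K.subset]
    by (auto simp: tensor_square_def tensor_product_def)
  have "c \<in> C" "d \<in> D" using cd K.rcos_self[OF _ K.subgroup_axioms] by auto
  with in_T presented_group_elements(1) have "\<Union>C \<noteq> {}" "\<Union>D \<noteq> {}" by blast+
  then have "(SOME w. w \<in> \<Union>C) \<in> \<Union>C" "(SOME w. w \<in> \<Union>D) \<in> \<Union>D"
    by (simp_all only: some_in_eq not_False_eq_True)
  with eq obtain w A B where "w \<in> A" "A \<in> C" "w \<in> B" "B \<in> D"
    unfolding wedge_code_def by auto
  with in_T have "A = B" using presented_group_elements(2)[OF in_T in_T, of A B w] by blast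
  with \<open>A \<in> C\<close> \<open>B \<in> D\<close> show "C = D"
    using cd K.repr_independence[OF _ _ K.subgroup_axioms, of A c]
      K.repr_independence[OF _ _ K.subgroup_axioms, of A d] by simp
qed


section \<open>Tensor powers\<close>

text \<open>The properties of a tensor power, its action and its commutator map that make the next tensor product
  meaningful and that the next stage inherits.  The multiplicativity of the action and the
  equivariance of \<open>\<lambda>\<close> are what the diagonal action needs in order to respect the relations.\<close>

locale crossed_stage = group G for G :: "'a monoid" (structure) +
  fixes S :: "'a tensor_stage"
  assumes group_stage: "group (stage_group S)"
    and lambda_hom: "stage_lambda S \<in> hom (stage_group S) G"
    and act_hom: "g \<in> carrier G \<Longrightarrow> stage_act S g \<in> hom (stage_group S) (stage_group S)"
    and act_mult: "\<lbrakk>g \<in> carrier G; h \<in> carrier G; t \<in> carrier (stage_group S)\<rbrakk> \<Longrightarrow>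
      stage_act S (g \<otimes> h) t = stage_act S g (stage_act S h t)"
    and lambda_act: "\<lbrakk>g \<in> carrier G; t \<in> carrier (stage_group S)\<rbrakk> \<Longrightarrow>
      stage_lambda S (stage_act S g t) = conjugate G g (stage_lambda S t)"
begin

abbreviation stage_pairing :: "('h, 'w) monoid_scheme \<Rightarrow> ('a tensor_elt \<times> 'a \<Rightarrow> 'h) \<Rightarrow> bool" where
  "stage_pairing \<equiv> crossed_pairing (stage_group S) G (stage_act_back G S) (stage_act S)"

lemma lambda_closed [simp]: "t \<in> carrier (stage_group S) \<Longrightarrow> stage_lambda S t \<in> carrier G"
  by (rule hom_in_carrier[OF lambda_hom])

lemma act_closed [simp]:
  "g \<in> carrier G \<Longrightarrow> t \<in> carrier (stage_group S) \<Longrightarrow> stage_act S g t \<in> carrier (stage_group S)"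
  by (rule hom_in_carrier[OF act_hom])

lemma act_back_closed [simp]:
  "t \<in> carrier (stage_group S) \<Longrightarrow> g \<in> carrier G \<Longrightarrow> stage_act_back G S t g \<in> carrier G"
  by (simp add: stage_act_back_def)

lemma inj_on_next_code: "inj_on tensor_code (carrier (next_tensor G S))"
  unfolding next_tensor_def by (rule inj_on_tensor_code)

lemma group_next_tensor: "group (next_tensor G S)"
  unfolding next_tensor_def by (rule group_tensor_product)

lemma stage_group_next: "stage_group (next_stage G S) = image_group tensor_code (next_tensor G S)"
  by (simp add: next_stage_def)

lemma group_next_stage: "group (stage_group (next_stage G S))"
  unfolding stage_group_next by (rule group_image_group[OF group_next_tensor inj_on_next_code])

lemma next_code_hom: "tensor_code \<in> hom (next_tensor G S) (stage_group (next_stage G S))"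
  unfolding stage_group_next by (rule image_group_encode[OF inj_on_next_code])

lemma crossed_pairing_next_symbol:
  "stage_pairing (stage_group (next_stage G S)) (\<lambda>(t, g). next_symbol G S t g)"
  using crossed_pairing_compose_hom[OF crossed_pairing_tensor_symbol[OF group_stage is_group]
      next_code_hom[unfolded next_tensor_def] group_stage is_group]
  by (simp add: next_symbol_def case_prod_unfold)

lemmas next_symbol_closed = crossed_pairingD(1)[OF crossed_pairing_next_symbol, simplified]

lemma generate_next_stage:
  "carrier (stage_group (next_stage G S)) = generate (stage_group (next_stage G S))
    {next_symbol G S t g | t g. t \<in> carrier (stage_group S) \<and> g \<in> carrier G}"
proof -
  let ?symbols = "{tensor_symbol (stage_group S) G (stage_act_back G S) (stage_act S) t g | t g.
    t \<in> carrier (stage_group S) \<and> g \<in> carrier G}"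
  have "{next_symbol G S t g | t g. t \<in> carrier (stage_group S) \<and> g \<in> carrier G}
      = tensor_code ` ?symbols"
    by (auto simp: next_symbol_def)
  moreover have "?symbols \<subseteq> carrier (next_tensor G S)"
    by (auto simp: next_tensor_def tensor_symbol_closed)
  ultimately show ?thesis
    using generate_image_group[OF group_next_tensor inj_on_next_code, of ?symbols]
      generate_tensor_product[of "stage_group S" G "stage_act_back G S" "stage_act S"]
    by (simp add: next_tensor_def stage_group_next)
qed

lemma next_lift:
  assumes "group H" "stage_pairing H \<phi>"
  shows "next_lift G S H \<phi> \<in> hom (stage_group (next_stage G S)) H"
    and "\<lbrakk>t \<in> carrier (stage_group S); g \<in> carrier G\<rbrakk> \<Longrightarrow>
      next_lift G S H \<phi> (next_symbol G S t g) = \<phi> (t, g)"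
proof -
  note lift = tensor_lift[OF assms, folded next_tensor_def]
  have "(\<lambda>t. presented_lift H \<phi> (inv_into (carrier (next_tensor G S)) tensor_code t))
      \<in> hom (stage_group (next_stage G S)) H"
    using Group.hom_compose[OF image_group_decode[OF group_next_tensor inj_on_next_code] lift(1)]
    by (simp add: stage_group_next comp_def)
  then show "next_lift G S H \<phi> \<in> hom (stage_group (next_stage G S)) H"
    by (simp add: next_lift_def[abs_def])
  show "next_lift G S H \<phi> (next_symbol G S t g) = \<phi> (t, g)"
    if "t \<in> carrier (stage_group S)" "g \<in> carrier G"
    using that lift(2)[OF that] inv_into_f_f[OF inj_on_next_code]
      tensor_symbol_closed[OF that, of "stage_act_back G S" "stage_act S"]
    by (simp add: next_lift_def next_symbol_def next_tensor_def)
qed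

lemma hom_eq_on_next_symbols:
  assumes "group H" "h \<in> hom (stage_group (next_stage G S)) H"
    "k \<in> hom (stage_group (next_stage G S)) H"
    and agree: "\<And>t g. \<lbrakk>t \<in> carrier (stage_group S); g \<in> carrier G\<rbrakk> \<Longrightarrow>
      h (next_symbol G S t g) = k (next_symbol G S t g)"
    and u: "u \<in> carrier (stage_group (next_stage G S))"
  shows "h u = k u"
  by (rule hom_agree_on_generate[OF group_next_stage assms(1-3) _ _ u[unfolded generate_next_stage]])
     (auto simp: next_symbol_closed agree)

lemma next_lambda:
  shows next_lambda_hom: "stage_lambda (next_stage G S) \<in> hom (stage_group (next_stage G S)) G"
    and next_lambda_symbol: "\<lbrakk>t \<in> carrier (stage_group S); g \<in> carrier G\<rbrakk> \<Longrightarrow>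
      stage_lambda (next_stage G S) (next_symbol G S t g) = commutator G (stage_lambda S t) g"
proof -
  have "stage_pairing G (\<lambda>(t, g). (\<lambda>(x, y). commutator G x y) (stage_lambda S t, g))"
    by (rule crossed_pairing_pullback[OF crossed_pairing_commutator
          group_homI[OF group_stage is_group lambda_hom] group_homI[OF is_group is_group iso_imp_homomorphism[OF iso_set_refl]]])
       (simp_all add: stage_act_back_def lambda_act)
  note lift = next_lift[OF is_group this[unfolded case_prod_conv]]
  show "stage_lambda (next_stage G S) \<in> hom (stage_group (next_stage G S)) G"
    using lift(1) by (simp add: next_stage_def)
  show "stage_lambda (next_stage G S) (next_symbol G S t g) = commutator G (stage_lambda S t) g"
    if "t \<in> carrier (stage_group S)" "g \<in> carrier G"
    using lift(2)[OF that] by (simp add: next_stage_def)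
qed

lemma next_act:
  assumes g: "g \<in> carrier G"
  shows next_act_hom: "stage_act (next_stage G S) g
      \<in> hom (stage_group (next_stage G S)) (stage_group (next_stage G S))"
    and next_act_symbol: "\<lbrakk>t \<in> carrier (stage_group S); h \<in> carrier G\<rbrakk> \<Longrightarrow>
      stage_act (next_stage G S) g (next_symbol G S t h)
        = next_symbol G S (stage_act S g t) (conjugate G g h)"
proof -
  interpret c: group_hom G G "conjugate G g"
    by (rule group_homI[OF is_group is_group conjugate_hom[OF g]])
  \<comment> \<open>This uses \<open>g x = (g x g\<^sup>-\<^sup>1) g\<close>; it says that acting by \<open>g\<close> is compatible with the action of \<open>G\<close> on the stage.\<close>
  have "stage_act S g (stage_act S x t) = stage_act S (conjugate G g x) (stage_act S g t)"
    if "t \<in> carrier (stage_group S)" "x \<in> carrier G" for t x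
    using that g by (simp add: free_reduction flip: act_mult)
  then have "stage_pairing (stage_group (next_stage G S))
      (\<lambda>(t, h). (\<lambda>(t, h). next_symbol G S t h) (stage_act S g t, conjugate G g h))"
    using g
    by (intro crossed_pairing_pullback[OF crossed_pairing_next_symbol
          group_homI[OF group_stage group_stage act_hom] c.group_hom_axioms])
       (simp_all add: stage_act_back_def lambda_act c.hom_conjugate)
  note lift = next_lift[OF group_next_stage this[unfolded case_prod_conv]]
  show "stage_act (next_stage G S) g
      \<in> hom (stage_group (next_stage G S)) (stage_group (next_stage G S))"
    using lift(1) by (simp add: next_stage_def)
  show "stage_act (next_stage G S) g (next_symbol G S t h)
      = next_symbol G S (stage_act S g t) (conjugate G g h)"
    if "t \<in> carrier (stage_group S)" "h \<in> carrier G"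
    using lift(2)[OF that] by (simp add: next_stage_def)
qed

lemma crossed_stage_next: "crossed_stage G (next_stage G S)"
proof (intro crossed_stage.intro crossed_stage_axioms.intro)
  show "group G" by (rule is_group)
  show "group (stage_group (next_stage G S))" by (rule group_next_stage)
  show "stage_lambda (next_stage G S) \<in> hom (stage_group (next_stage G S)) G"
    by (rule next_lambda_hom)
  show "stage_act (next_stage G S) g
      \<in> hom (stage_group (next_stage G S)) (stage_group (next_stage G S))"
    if "g \<in> carrier G" for g
    by (rule next_act_hom[OF that])
next
  fix g h u assume g: "g \<in> carrier G" and h: "h \<in> carrier G"
    and u: "u \<in> carrier (stage_group (next_stage G S))"
  show "stage_act (next_stage G S) (g \<otimes> h) u
      = stage_act (next_stage G S) g (stage_act (next_stage G S) h u)"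
    by (rule hom_eq_on_next_symbols[OF group_next_stage next_act_hom
          Group.hom_compose[OF next_act_hom next_act_hom, unfolded comp_def, of h g] _ u])
       (use g h in \<open>simp_all add: next_act_symbol act_mult conjugate_mult\<close>)
next
  fix g u assume g: "g \<in> carrier G" and u: "u \<in> carrier (stage_group (next_stage G S))"
  show "stage_lambda (next_stage G S) (stage_act (next_stage G S) g u)
      = conjugate G g (stage_lambda (next_stage G S) u)"
    by (rule hom_eq_on_next_symbols[OF is_group
          Group.hom_compose[OF next_act_hom next_lambda_hom, unfolded comp_def, of g]
          Group.hom_compose[OF next_lambda_hom conjugate_hom, unfolded comp_def, of g] _ u])
       (use g in \<open>simp_all add: next_act_symbol next_lambda_symbol lambda_act conjugate_commutator\<close>)
qed

end

lemma image_group_base: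
  assumes "group G" "inj f"
  shows "\<lbrakk>x \<in> carrier G; y \<in> carrier G\<rbrakk> \<Longrightarrow> f x \<otimes>\<^bsub>image_group f G\<^esub> f y = f (x \<otimes>\<^bsub>G\<^esub> y)"
    and "group (image_group f G)"
  using assms
  by (simp_all add: image_group_def inj_on_subset group_image_group[OF assms(1), unfolded image_group_def])

lemma crossed_stage_tensor_stages:
  assumes "group G"
  shows "crossed_stage G (tensor_stages G k)"
proof (induction k)
  case 0
  interpret group G by (rule assms)
  have "inj Tensor_Base" by (rule injI) simp
  note base = image_group_base[OF assms this]
  show ?case
    by (intro crossed_stage.intro crossed_stage_axioms.intro)
       (auto simp: base image_group_carrier hom_def free_reduction)
next
  case (Suc k)
  then show ?case by (simp add: crossed_stage.crossed_stage_next)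
qed

text \<open>Functoriality must be proved together with compatibility with the actions and with \<open>\<lambda>\<close>: these are
  what the map at one stage needs to respect the relations of the next.\<close>

lemma tensor_stage_map:
  fixes \<Gamma> :: "'c monoid" and G :: "'a monoid"
  assumes f: "group_hom \<Gamma> G f"
  shows "tensor_stage_map \<Gamma> G f k
      \<in> hom (stage_group (tensor_stages \<Gamma> k)) (stage_group (tensor_stages G k))"
    and "\<And>x t. \<lbrakk>x \<in> carrier \<Gamma>; t \<in> carrier (stage_group (tensor_stages \<Gamma> k))\<rbrakk> \<Longrightarrow>
      tensor_stage_map \<Gamma> G f k (stage_act (tensor_stages \<Gamma> k) x t)
        = stage_act (tensor_stages G k) (f x) (tensor_stage_map \<Gamma> G f k t)"
    and "\<And>t. t \<in> carrier (stage_group (tensor_stages \<Gamma> k)) \<Longrightarrow>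
      stage_lambda (tensor_stages G k) (tensor_stage_map \<Gamma> G f k t)
        = f (stage_lambda (tensor_stages \<Gamma> k) t)"
    and "\<And>t x. \<lbrakk>t \<in> carrier (stage_group (tensor_stages \<Gamma> k)); x \<in> carrier \<Gamma>\<rbrakk> \<Longrightarrow>
      tensor_stage_map \<Gamma> G f (Suc k) (next_symbol \<Gamma> (tensor_stages \<Gamma> k) t x)
        = next_symbol G (tensor_stages G k) (tensor_stage_map \<Gamma> G f k t) (f x)"
proof -
  interpret f: group_hom \<Gamma> G f by (rule f)
  have stage: "crossed_stage \<Gamma> (tensor_stages \<Gamma> k)" "crossed_stage G (tensor_stages G k)" for k
    by (simp_all add: crossed_stage_tensor_stages)
  let ?f = "tensor_stage_map \<Gamma> G f" and ?S = "tensor_stages \<Gamma>" and ?S' = "tensor_stages G"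
  define natural where "natural k \<longleftrightarrow>
      ?f k \<in> hom (stage_group (?S k)) (stage_group (?S' k))
    \<and> (\<forall>x \<in> carrier \<Gamma>. \<forall>t \<in> carrier (stage_group (?S k)).
        ?f k (stage_act (?S k) x t) = stage_act (?S' k) (f x) (?f k t))
    \<and> (\<forall>t \<in> carrier (stage_group (?S k)). stage_lambda (?S' k) (?f k t) = f (stage_lambda (?S k) t))"
    for k
  have step: "?f (Suc k) \<in> hom (stage_group (?S (Suc k))) (stage_group (?S' (Suc k))) \<and>
      (\<forall>t \<in> carrier (stage_group (?S k)). \<forall>x \<in> carrier \<Gamma>.
        ?f (Suc k) (next_symbol \<Gamma> (?S k) t x) = next_symbol G (?S' k) (?f k t) (f x))"
    if "natural k" for k
  proof -
    interpret S: crossed_stage \<Gamma> "?S k" by (rule stage)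
    interpret S': crossed_stage G "?S' k" by (rule stage)
    have "S.stage_pairing (stage_group (next_stage G (?S' k)))
        (\<lambda>(t, x). (\<lambda>(t, g). next_symbol G (?S' k) t g) (?f k t, f x))"
      using that
      by (intro crossed_pairing_pullback[OF S'.crossed_pairing_next_symbol
            group_homI[OF S.group_stage S'.group_stage] f])
         (simp_all add: natural_def stage_act_back_def f.hom_conjugate)
    from S.next_lift[OF S'.group_next_stage this[unfolded case_prod_conv]]
    show ?thesis by simp
  qed
  have natural: "natural k" for k
  proof (induction k)
    case 0
    have inj: "inj Tensor_Base" "inj Tensor_Base" by (rule injI, simp)+
    note base = image_group_base[OF f.G.is_group inj(1)] image_group_base[OF f.H.is_group inj(2)]
    show ?case
      by (auto simp: natural_def image_group_carrier hom_def base f.hom_conjugate)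
  next
    case (Suc k)
    interpret S: crossed_stage \<Gamma> "?S k" by (rule stage)
    interpret S': crossed_stage G "?S' k" by (rule stage)
    note f_hom = step[OF Suc, THEN conjunct1, simplified]
    have symbol: "?f (Suc k) (next_symbol \<Gamma> (?S k) t x) = next_symbol G (?S' k) (?f k t) (f x)"
      if "t \<in> carrier (stage_group (?S k))" "x \<in> carrier \<Gamma>" for t x
      using step[OF Suc] that by blast
    note symbol = symbol[unfolded tensor_stage_map.simps tensor_stages.simps]
    have "?f k \<in> hom (stage_group (?S k)) (stage_group (?S' k))" using Suc by (simp add: natural_def)
    then have k_closed: "?f k t \<in> carrier (stage_group (?S' k))" if "t \<in> carrier (stage_group (?S k))" for t
      by (rule hom_in_carrier) (rule that)
    have act_k: "?f k (stage_act (?S k) x t) = stage_act (?S' k) (f x) (?f k t)"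
      "stage_lambda (?S' k) (?f k t) = f (stage_lambda (?S k) t)"
      if "t \<in> carrier (stage_group (?S k))" "x \<in> carrier \<Gamma>" for x t
      using Suc that by (simp_all add: natural_def)
    have act: "?f (Suc k) (stage_act (next_stage \<Gamma> (?S k)) x u)
        = stage_act (next_stage G (?S' k)) (f x) (?f (Suc k) u)"
      if x: "x \<in> carrier \<Gamma>" and u: "u \<in> carrier (stage_group (next_stage \<Gamma> (?S k)))" for x u
      unfolding tensor_stage_map.simps tensor_stages.simps
      by (rule S.hom_eq_on_next_symbols[OF S'.group_next_stage
            Group.hom_compose[OF S.next_act_hom f_hom, unfolded comp_def, of x]
            Group.hom_compose[OF f_hom S'.next_act_hom, unfolded comp_def, of "f x"] _ u])
         (use x in \<open>simp_all add: S.next_act_symbol symbol k_closed act_k S'.next_act_symbol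
            f.hom_conjugate\<close>)
    have "stage_lambda (next_stage G (?S' k)) (?f (Suc k) u)
        = f (stage_lambda (next_stage \<Gamma> (?S k)) u)"
      if u: "u \<in> carrier (stage_group (next_stage \<Gamma> (?S k)))" for u
      unfolding tensor_stage_map.simps tensor_stages.simps
      by (rule S.hom_eq_on_next_symbols[OF f.H.is_group
            Group.hom_compose[OF f_hom S'.next_lambda_hom, unfolded comp_def]
            Group.hom_compose[OF S.next_lambda_hom f.homh, unfolded comp_def] _ u])
         (simp_all add: symbol k_closed act_k S.next_lambda_symbol S'.next_lambda_symbol
            f.hom_commutator)
    with act step[OF Suc] show ?case by (simp add: natural_def)
  qed
  show "?f k \<in> hom (stage_group (?S k)) (stage_group (?S' k))"
    and "\<And>x t. \<lbrakk>x \<in> carrier \<Gamma>; t \<in> carrier (stage_group (?S k))\<rbrakk> \<Longrightarrow>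
      ?f k (stage_act (?S k) x t) = stage_act (?S' k) (f x) (?f k t)"
    and "\<And>t. t \<in> carrier (stage_group (?S k)) \<Longrightarrow>
      stage_lambda (?S' k) (?f k t) = f (stage_lambda (?S k) t)"
    using natural by (auto simp: natural_def)
  show "?f (Suc k) (next_symbol \<Gamma> (?S k) t x) = next_symbol G (?S' k) (?f k t) (f x)"
    if "t \<in> carrier (stage_group (?S k))" "x \<in> carrier \<Gamma>" for t x
    using step[OF natural] that by blast
qed


section \<open>Exterior powers\<close>

text \<open>Exterior squares use only conjugation actions, so no structure beyond the group is carried from one
  stage to the next.\<close>

locale wedge_step = group E for E :: "'a wedge_elt monoid"
begin

abbreviation next_wedge :: "'a wedge_elt monoid" where
  "next_wedge \<equiv> image_group wedge_code (exterior_square E)"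

lemma group_next_wedge: "group next_wedge"
  by (rule group_image_group[OF group_exterior_square inj_on_wedge_code[OF is_group]])

lemma wedge_code_hom: "wedge_code \<in> hom (exterior_square E) next_wedge"
  by (rule image_group_encode[OF inj_on_wedge_code[OF is_group]])

lemma alternating_pairing_next_wedge_symbol:
  "alternating_pairing E next_wedge (\<lambda>(a, b). next_wedge_symbol E a b)"
proof -
  have "crossed_pairing E E (conjugate E) (conjugate E) next_wedge
      (\<lambda>z. wedge_code ((\<lambda>(a, b). wedge_symbol E a b) z))"
    by (rule crossed_pairing_compose_hom[OF crossed_pairing_wedge_symbol wedge_code_hom
          is_group is_group]) simp_all
  moreover have "wedge_code (wedge_symbol E a a) = \<one>\<^bsub>next_wedge\<^esub>" if "a \<in> carrier E" for a
    using that by (simp add: wedge_symbol_self image_group_one)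
  ultimately show ?thesis by (simp add: alternating_pairing_def next_wedge_symbol_def case_prod_unfold)
qed

lemmas next_wedge_symbol_closed =
  crossed_pairingD(1)[OF alternating_pairingD(1)[OF alternating_pairing_next_wedge_symbol],
    simplified]

lemma generate_next_wedge:
  "carrier next_wedge = generate next_wedge
    {next_wedge_symbol E a b | a b. a \<in> carrier E \<and> b \<in> carrier E}"
proof -
  let ?symbols = "{wedge_symbol E a b | a b. a \<in> carrier E \<and> b \<in> carrier E}"
  have "{next_wedge_symbol E a b | a b. a \<in> carrier E \<and> b \<in> carrier E} = wedge_code ` ?symbols"
    by (auto simp: next_wedge_symbol_def)
  moreover have "?symbols \<subseteq> carrier (exterior_square E)"
    by (auto simp: wedge_symbol_closed)
  ultimately show ?thesis
    using generate_image_group[OF group_exterior_square inj_on_wedge_code[OF is_group]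
        generate_exterior_square]
    by simp
qed

lemma next_wedge_lift:
  assumes "group H" "alternating_pairing E H \<phi>"
  shows "next_wedge_lift E H \<phi> \<in> hom next_wedge H"
    and "\<lbrakk>a \<in> carrier E; b \<in> carrier E\<rbrakk> \<Longrightarrow>
      next_wedge_lift E H \<phi> (next_wedge_symbol E a b) = \<phi> (a, b)"
proof -
  note lift = exterior_lift[OF assms]
  note code = inj_on_wedge_code[OF is_group]
  show "next_wedge_lift E H \<phi> \<in> hom next_wedge H"
    using Group.hom_compose[OF image_group_decode[OF group_exterior_square code] lift(1)]
    by (simp add: next_wedge_lift_def[abs_def] comp_def)
  show "next_wedge_lift E H \<phi> (next_wedge_symbol E a b) = \<phi> (a, b)"
    if "a \<in> carrier E" "b \<in> carrier E"
    using lift(2)[OF that] inv_into_f_f[OF code wedge_symbol_closed[OF that]]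
    by (simp add: next_wedge_lift_def next_wedge_symbol_def)
qed

end

lemma group_wedge_stage:
  assumes "group G"
  shows "group (wedge_stage G k)"
proof (induction k)
  case 0
  have "inj Wedge_Base" by (rule injI) simp
  then show ?case using image_group_base(2)[OF assms] by simp
next
  case (Suc k)
  then show ?case using wedge_step.group_next_wedge wedge_step.intro by fastforce
qed

lemma wedge_mu:
  assumes "group G"
  shows wedge_mu_hom: "wedge_stage_mu G k \<in> hom (wedge_stage G k) G"
    and wedge_mu_symbol: "\<lbrakk>a \<in> carrier (wedge_stage G k); b \<in> carrier (wedge_stage G k)\<rbrakk> \<Longrightarrow>
      wedge_stage_mu G (Suc k) (next_wedge_symbol (wedge_stage G k) a b)
        = commutator G (wedge_stage_mu G k a) (wedge_stage_mu G k b)"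
proof -
  interpret group G by (rule assms)
  have step: "wedge_stage_mu G (Suc k) \<in> hom (wedge_stage G (Suc k)) G \<and>
      (\<forall>a \<in> carrier (wedge_stage G k). \<forall>b \<in> carrier (wedge_stage G k).
        wedge_stage_mu G (Suc k) (next_wedge_symbol (wedge_stage G k) a b)
          = commutator G (wedge_stage_mu G k a) (wedge_stage_mu G k b))"
    if "wedge_stage_mu G k \<in> hom (wedge_stage G k) G" for k
  proof -
    interpret wedge_step "wedge_stage G k" by (rule wedge_step.intro[OF group_wedge_stage[OF assms]])
    have "alternating_pairing (wedge_stage G k) G
        (\<lambda>(a, b). (\<lambda>(x, y). commutator G x y) (wedge_stage_mu G k a, wedge_stage_mu G k b))"
      by (rule alternating_pairing_pullback[OF group.alternating_pairing_commutator[OF assms]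
            group_homI[OF is_group assms that]])
    from next_wedge_lift[OF assms this[unfolded case_prod_conv]] show ?thesis by simp
  qed
  show mu_hom: "wedge_stage_mu G k \<in> hom (wedge_stage G k) G" for k
  proof (induction k)
    case 0
    have "inj Wedge_Base" by (rule injI) simp
    note base = image_group_base[OF assms this]
    show ?case by (auto simp: base image_group_carrier hom_def)
  qed (use step in blast)
  show "wedge_stage_mu G (Suc k) (next_wedge_symbol (wedge_stage G k) a b)
        = commutator G (wedge_stage_mu G k a) (wedge_stage_mu G k b)"
    if "a \<in> carrier (wedge_stage G k)" "b \<in> carrier (wedge_stage G k)"
    using step[OF mu_hom] that by blast
qed

lemma wedge_stage_map:
  fixes \<Gamma> :: "'c monoid" and G :: "'a monoid"
  assumes f: "group_hom \<Gamma> G f"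
  shows "wedge_stage_map \<Gamma> G f k \<in> hom (wedge_stage \<Gamma> k) (wedge_stage G k)"
    and "\<And>a b. \<lbrakk>a \<in> carrier (wedge_stage \<Gamma> k); b \<in> carrier (wedge_stage \<Gamma> k)\<rbrakk> \<Longrightarrow>
      wedge_stage_map \<Gamma> G f (Suc k) (next_wedge_symbol (wedge_stage \<Gamma> k) a b)
        = next_wedge_symbol (wedge_stage G k) (wedge_stage_map \<Gamma> G f k a) (wedge_stage_map \<Gamma> G f k b)"
proof -
  interpret f: group_hom \<Gamma> G f by (rule f)
  let ?f = "wedge_stage_map \<Gamma> G f"
  have step: "?f (Suc k) \<in> hom (wedge_stage \<Gamma> (Suc k)) (wedge_stage G (Suc k)) \<and>
      (\<forall>a \<in> carrier (wedge_stage \<Gamma> k). \<forall>b \<in> carrier (wedge_stage \<Gamma> k).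
        ?f (Suc k) (next_wedge_symbol (wedge_stage \<Gamma> k) a b)
          = next_wedge_symbol (wedge_stage G k) (?f k a) (?f k b))"
    if "?f k \<in> hom (wedge_stage \<Gamma> k) (wedge_stage G k)" for k
  proof -
    interpret S: wedge_step "wedge_stage \<Gamma> k"
      by (rule wedge_step.intro[OF group_wedge_stage[OF f.G.is_group]])
    interpret S': wedge_step "wedge_stage G k"
      by (rule wedge_step.intro[OF group_wedge_stage[OF f.H.is_group]])
    have "alternating_pairing (wedge_stage \<Gamma> k) S'.next_wedge
        (\<lambda>(a, b). (\<lambda>(a, b). next_wedge_symbol (wedge_stage G k) a b) (?f k a, ?f k b))"
      by (rule alternating_pairing_pullback[OF S'.alternating_pairing_next_wedge_symbol
            group_homI[OF S.is_group S'.is_group that]])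
    from S.next_wedge_lift[OF S'.group_next_wedge this[unfolded case_prod_conv]]
    show ?thesis by simp
  qed
  show f_hom: "?f k \<in> hom (wedge_stage \<Gamma> k) (wedge_stage G k)" for k
  proof (induction k)
    case 0
    have inj: "inj Wedge_Base" "inj Wedge_Base" by (rule injI, simp)+
    note base = image_group_base[OF f.G.is_group inj(1)] image_group_base[OF f.H.is_group inj(2)]
    show ?case by (auto simp: image_group_carrier hom_def base)
  qed (use step in blast)
  show "?f (Suc k) (next_wedge_symbol (wedge_stage \<Gamma> k) a b)
      = next_wedge_symbol (wedge_stage G k) (?f k a) (?f k b)"
    if "a \<in> carrier (wedge_stage \<Gamma> k)" "b \<in> carrier (wedge_stage \<Gamma> k)" for a b
    using step[OF f_hom] that by blast
qed


section \<open>Central and derived series\<close>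

lemma lower_central_1: "lower_central G (Suc 0) = carrier G"
  by (simp add: lower_central_def)

lemma lower_central_Suc:
  "lower_central G (Suc (Suc k)) = commutator_subgroup G (lower_central G (Suc k)) (carrier G)"
  by (simp add: lower_central_def)

lemma derived_series_1: "derived_series G (Suc 0) = carrier G"
  by (simp add: derived_series_def)

lemma derived_series_Suc:
  "derived_series G (Suc (Suc k))
    = commutator_subgroup G (derived_series G (Suc k)) (derived_series G (Suc k))"
proof -
  have "derived_set G H = {commutator G a b | a b. a \<in> H \<and> b \<in> H}" for H
    by (auto simp: commutator_def)
  then have "derived G H = commutator_subgroup G H H" for H
    by (simp add: derived_def commutator_subgroup_def)
  then show ?thesis by (simp add: derived_series_def)
qed

lemma (in group_hom) lower_central_img:
  assumes "h ` carrier G = carrier H"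
  shows "lower_central G (Suc k) \<subseteq> carrier G \<and>
    h ` lower_central G (Suc k) = lower_central H (Suc k)"
proof (induction k)
  case (Suc k)
  then show ?case
    using assms G.commutator_subgroup_subgroup[THEN subgroup.subset]
    by (simp add: lower_central_Suc commutator_subgroup_img)
qed (simp add: lower_central_1 assms)

lemma (in group_hom) derived_series_img:
  assumes "h ` carrier G = carrier H"
  shows "derived_series G (Suc k) \<subseteq> carrier G \<and>
    h ` derived_series G (Suc k) = derived_series H (Suc k)"
proof (induction k)
  case (Suc k)
  then show ?case
    using assms G.commutator_subgroup_subgroup[THEN subgroup.subset]
    by (simp add: derived_series_Suc commutator_subgroup_img)
qed (simp add: derived_series_1 assms)

context group
begin

lemma normal_conjugate: "N \<lhd> G \<Longrightarrow> g \<in> carrier G \<Longrightarrow> x \<in> N \<Longrightarrow> conjugate G g x \<in> N"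
  by (simp add: conjugate_def normal.inv_op_closed2)

lemma lower_central_normal: "lower_central G (Suc k) \<lhd> G"
  by (induction k)
     (simp_all add: lower_central_1 lower_central_Suc normal_self commutator_subgroup_normal)

lemma derived_series_normal: "derived_series G (Suc k) \<lhd> G"
  by (induction k)
     (simp_all add: derived_series_1 derived_series_Suc normal_self commutator_subgroup_normal)

text \<open>This is the preimage in \<open>D\<close> of the centralizer of the image of \<open>A\<close> in \<open>G/S\<close>.\<close>

lemma subgroup_commutators_into_normal:
  assumes D: "subgroup D G" and A: "A \<subseteq> carrier G" and S: "S \<lhd> G"
  shows "subgroup {g \<in> D. \<forall>y \<in> A. commutator G g y \<in> S} G" (is "subgroup ?C G")
proof -
  interpret D: subgroup D G by (rule D)
  interpret S: normal S G by (rule S)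
  have A: "y \<in> carrier G" if "y \<in> A" for y using that A by blast
  show ?thesis
  proof (rule subgroupI)
    have "commutator G \<one> y = \<one>" if "y \<in> A" for y using A[OF that] by (simp add: commutator_def)
    then have "\<one> \<in> ?C" by simp
    then show "?C \<noteq> {}" by blast
    show "inv g \<in> ?C" if "g \<in> ?C" for g
    proof -
      have "commutator G (inv g) y = conjugate G (inv g) (inv (commutator G g y))" if "y \<in> A" for y
        using \<open>g \<in> ?C\<close> A[OF that] by (simp add: free_reduction)
      then show ?thesis using that by (simp add: normal_conjugate[OF S])
    qed
    show "g \<otimes> h \<in> ?C" if "g \<in> ?C" "h \<in> ?C" for g h
    proof -
      have "commutator G (g \<otimes> h) y = conjugate G g (commutator G h y) \<otimes> commutator G g y"
        if "y \<in> A" for y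
        using \<open>g \<in> ?C\<close> \<open>h \<in> ?C\<close> A[OF that] by (simp add: free_reduction)
      then show ?thesis using that by (simp add: normal_conjugate[OF S])
    qed
  qed auto
qed

text \<open>These elements form the preimage of the centre of the image of \<open>D\<close> in \<open>G/S\<close>.  The terms of the
  upper central series arise in this way from \<open>D = G\<close>, those of the chain \<open>annihilator_term\<close> from
  terms of the derived series.\<close>

lemma relative_centre_normal:
  assumes D: "D \<lhd> G" and S: "S \<lhd> G"
  shows "{g \<in> D. \<forall>y \<in> D. commutator G g y \<in> S} \<lhd> G"
proof -
  interpret D: normal D G by (rule D)
  interpret S: normal S G by (rule S)
  let ?C = "{g \<in> D. \<forall>y \<in> D. commutator G g y \<in> S}"
  have "subgroup ?C G"
    by (rule subgroup_commutators_into_normal[OF D.subgroup_axioms D.subset S])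
  moreover have "x \<otimes> g \<otimes> inv x \<in> ?C" if "x \<in> carrier G" "g \<in> ?C" for x g
  proof -
    have "commutator G (conjugate G x g) y
        = conjugate G x (commutator G g (conjugate G (inv x) y))" if "y \<in> D" for y
      using \<open>g \<in> ?C\<close> \<open>x \<in> carrier G\<close> that by (simp add: free_reduction)
    then have "conjugate G x g \<in> ?C"
      using that by (simp add: normal_conjugate[OF S] normal_conjugate[OF D])
    then show ?thesis by (simp add: conjugate_def)
  qed
  ultimately show ?thesis by (auto simp: normal_inv_iff)
qed

lemma upper_central_normal: "upper_central G k \<lhd> G"
  by (induction k) (simp_all add: one_is_normal relative_centre_normal[OF normal_self])

text \<open>The group-theoretic form of the Jacobi identity.\<close>

lemma Hall_Witt:
  assumes "x \<in> carrier G" "y \<in> carrier G" "z \<in> carrier G"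
  shows "commutator G (commutator G x y) (conjugate G y z)
    \<otimes> commutator G (commutator G y z) (conjugate G z x)
    \<otimes> commutator G (commutator G z x) (conjugate G x y) = \<one>"
  using assms by (simp add: free_reduction)

text \<open>The three subgroups argument.  By the Hall-Witt identity, \<open>[[u, g], z]\<close> is a product of conjugates and
  inverses of commutators of the forms \<open>[[g, z], u]\<close> and \<open>[[z, u], g]\<close>; taking the commutator of \<open>z\<close>
  with \<open>g\<close> lowers its position in the upper central series by one and taking it with
  \<open>u\<close> lowers it as far as the induction hypothesis says.\<close>

lemma lower_central_commutes_with_upper_central:
  assumes "x \<in> lower_central G (Suc k)" "z \<in> upper_central G (m + Suc k)"
  shows "commutator G x z \<in> upper_central G m"
  using assms
proof (induction k arbitrary: x z m)
  case 0
  interpret Z: normal "upper_central G m" G by (rule upper_central_normal)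
  from 0 have "inv (commutator G z x) \<in> upper_central G m" by (simp add: lower_central_1)
  then show ?case using 0 commutator_flip[of x z] by (simp add: lower_central_1)
next
  case (Suc k)
  interpret \<gamma>: normal "lower_central G (Suc k)" G by (rule lower_central_normal)
  have sub: "upper_central G i \<subseteq> carrier G" for i
    using upper_central_normal normal_imp_subgroup subgroup.subset by blast
  interpret Z: normal "upper_central G m" G by (rule upper_central_normal)
  let ?C = "{x \<in> carrier G. \<forall>z \<in> upper_central G (m + Suc (Suc k)).
    commutator G x z \<in> upper_central G m}"
  have "subgroup ?C G"
    by (rule subgroup_commutators_into_normal[OF subgroup_self sub upper_central_normal])
  moreover have "commutator G u g \<in> ?C" if u: "u \<in> lower_central G (Suc k)" and g: "g \<in> carrier G" for u g
  proof -
    have "commutator G (commutator G u g) z \<in> upper_central G m"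
      if z: "z \<in> upper_central G (m + Suc (Suc k))" for z
    proof -
      \<comment> \<open>The last entry of the first factor in the Hall-Witt identity is a conjugate by \<open>g\<close>; this \<open>w\<close> makes it equal to \<open>z\<close>.\<close>
      define w where "w = conjugate G (inv g) z"
      have zc: "z \<in> carrier G" using z sub by blast
      have w: "w \<in> upper_central G (Suc (m + Suc k))" "w \<in> carrier G"
        using z zc g by (simp_all add: w_def normal_conjugate[OF upper_central_normal] del: upper_central.simps)
      have uc: "u \<in> carrier G" using u by simp
      have "conjugate G g w = z" using zc g by (simp add: w_def free_reduction)
      then have HW: "commutator G (commutator G u g) z
          \<otimes> commutator G (commutator G g w) (conjugate G w u)
          \<otimes> commutator G (commutator G w u) (conjugate G u g) = \<one>"
        using Hall_Witt[OF uc g w(2)] by simp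
      have "commutator G w g \<in> upper_central G (m + Suc k)" using w g by simp
      then have "commutator G g w \<in> upper_central G (m + Suc k)"
        using commutator_flip[OF g w(2)]
          subgroup.m_inv_closed[OF normal_imp_subgroup[OF upper_central_normal]]
        by (simp del: upper_central.simps)
      moreover have "conjugate G w u \<in> lower_central G (Suc k)"
        using u w by (simp add: normal_conjugate[OF lower_central_normal])
      ultimately have "commutator G (conjugate G w u) (commutator G g w) \<in> upper_central G m"
        by (rule Suc.IH[rotated])
      then have 1: "commutator G (commutator G g w) (conjugate G w u) \<in> upper_central G m"
        using commutator_flip[of "commutator G g w" "conjugate G w u"] g w(2) uc Z.m_inv_closed
        by simp
      have "commutator G u w \<in> upper_central G (Suc m)"
        by (rule Suc.IH[OF u]) (use w(1) in \<open>simp only: add_Suc add_Suc_right\<close>)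
      then have "commutator G w u \<in> upper_central G (Suc m)"
        using commutator_flip[OF w(2) uc]
          subgroup.m_inv_closed[OF normal_imp_subgroup[OF upper_central_normal]]
        by (simp del: upper_central.simps)
      then have 2: "commutator G (commutator G w u) (conjugate G u g) \<in> upper_central G m"
        using uc g by simp
      have "commutator G (commutator G u g) z
        = inv (commutator G (commutator G g w) (conjugate G w u)
          \<otimes> commutator G (commutator G w u) (conjugate G u g))"
        by (rule inv_equality[symmetric]) (use HW zc uc g w(2) in \<open>simp_all add: m_assoc\<close>)
      then show ?thesis using 1 2 by simp
    qed
    then show ?thesis using u g by (simp del: upper_central.simps)
  qed
  ultimately have "lower_central G (Suc (Suc k)) \<subseteq> ?C"
    unfolding lower_central_Suc commutator_subgroup_def by (intro generate_subgroup_incl) auto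
  then show ?case using Suc.prems by blast
qed

end

text \<open>The elements of the term \<open>k + 1\<close> of the derived series that vanish after \<open>r\<close> commutators with elements of
  the terms \<open>k + 1\<close>, ..., \<open>k + r\<close>.  Compared with \<open>derived_annihilator\<close>, the commutators are peeled off
  from the inside, which makes normality evident and matches the passage from one exterior power
  to the next.\<close>

primrec annihilator_term :: "('a, 'z) monoid_scheme \<Rightarrow> nat \<Rightarrow> nat \<Rightarrow> 'a set" where
  "annihilator_term G 0 k = {\<one>\<^bsub>G\<^esub>}"
| "annihilator_term G (Suc r) k = {g \<in> derived_series G (Suc k).
     \<forall>y \<in> derived_series G (Suc k). commutator G g y \<in> annihilator_term G r (Suc k)}"

lemma (in group) annihilator_term_normal: "annihilator_term G r k \<lhd> G"
  by (induction r arbitrary: k)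
     (simp_all add: one_is_normal relative_centre_normal derived_series_normal)

lemma (in group) annihilator_termI:
  assumes "g \<in> derived_series G (Suc k)"
    and "\<And>x. (\<And>i. i \<in> {1..r} \<Longrightarrow> x i \<in> derived_series G (k + i)) \<Longrightarrow>
      foldl (commutator G) g (map x [1..<Suc r]) = \<one>"
  shows "g \<in> annihilator_term G r k"
  using assms
proof (induction r arbitrary: g k)
  case 0
  then show ?case by simp
next
  case (Suc r)
  have "commutator G g y \<in> annihilator_term G r (Suc k)" if y: "y \<in> derived_series G (Suc k)" for y
  proof (rule Suc.IH)
    show "commutator G g y \<in> derived_series G (Suc (Suc k))"
      unfolding derived_series_Suc
      by (rule commutator_in_commutator_subgroup[OF Suc.prems(1) y])
    fix x
    assume x: "\<And>i. i \<in> {1..r} \<Longrightarrow> x i \<in> derived_series G (Suc k + i)"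
    \<comment> \<open>The commutator with \<open>y\<close> comes first, so the entries of \<open>x\<close> are shifted by one place.\<close>
    define x' where "x' i = (if i = 1 then y else x (i - 1))" for i
    have "x' i \<in> derived_series G (k + i)" if "i \<in> {1..Suc r}" for i
    proof (cases "i = 1")
      case False
      with that have "i - 1 \<in> {1..r}" "Suc k + (i - 1) = k + i" by auto
      with x[of "i - 1"] False show ?thesis by (simp add: x'_def)
    qed (simp add: x'_def y)
    then have "foldl (commutator G) g (map x' [1..<Suc (Suc r)]) = \<one>"
      by (rule Suc.prems(2))
    moreover have "map x' [1..<Suc (Suc r)] = y # map x [1..<Suc r]"
    proof -
      have "map x' [1..<Suc (Suc r)] = x' 1 # map x' (map Suc [1..<Suc r])"
        by (simp only: map_Suc_upt upt_conv_Cons[of 1 "Suc (Suc r)"] list.map)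
      also have "\<dots> = y # map x [1..<Suc r]" by (simp add: x'_def del: upt_Suc)
      finally show ?thesis .
    qed
    ultimately show "foldl (commutator G) (commutator G g y) (map x [1..<Suc r]) = \<one>"
      by (simp del: upt_Suc)
  qed
  then show ?case using Suc.prems(1) by simp
qed

lemma (in group) derived_annihilator_subset: "derived_annihilator G r \<subseteq> annihilator_term G r 0"
  by (rule subsetI, rule annihilator_termI) (auto simp: derived_annihilator_def derived_series_1)


section \<open>Subgroups of lifts\<close>

text \<open>A subgroup of \<open>M \<times> E\<close> is a multivalued map from \<open>M\<close> to \<open>E\<close>.  From such maps \<open>R\<close> on \<open>M\<close> and \<open>Q\<close> on \<open>N\<close>,
  this produces the multivalued map that sends the symbol \<open>m \<otimes> n\<close> to the commutators of values at
  \<open>m\<close> and \<open>n\<close>.\<close>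

definition commutator_lifts ::
  "('x, 'u) monoid_scheme \<Rightarrow> ('b, 'v) monoid_scheme \<Rightarrow> ('m \<Rightarrow> 'n \<Rightarrow> 'x) \<Rightarrow>
   ('m \<times> 'b) set \<Rightarrow> ('n \<times> 'b) set \<Rightarrow> ('x \<times> 'b) set" where
  "commutator_lifts X E symb R Q =
     generate (X \<times>\<times> E) {(symb m n, commutator E x y) | m x n y. (m, x) \<in> R \<and> (n, y) \<in> Q}"

lemma hom_generate_into_subgroup:
  assumes "group_hom K H h" "subgroup B H" "S \<subseteq> carrier K" "h ` S \<subseteq> B" "x \<in> generate K S"
  shows "h x \<in> B"
proof -
  interpret group_hom K H h by (rule assms)
  have "generate K S \<subseteq> {x \<in> carrier K. h x \<in> B}"
    using assms(3,4) by (intro G.generate_subgroup_incl subgroup_vimage[OF assms(2)]) auto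
  then show ?thesis using assms(5) by blast
qed

text \<open>The common step of both constructions: \<open>X\<close> is generated by symbols indexed by \<open>M \<times> N\<close>.  For tensor powers
  \<open>N\<close> is the base group and \<open>Q\<close> the inverse of \<open>p\<close>; for exterior powers \<open>N = M\<close> and \<open>Q = R\<close>.\<close>

locale lift_step = M: group M + N: group N + X: group X + E: group E
  for M :: "('m, 'r) monoid_scheme" and N :: "('n, 's) monoid_scheme"
    and X :: "('x, 't) monoid_scheme" and E :: "('b, 'v) monoid_scheme" +
  fixes symb :: "'m \<Rightarrow> 'n \<Rightarrow> 'x" and R :: "('m \<times> 'b) set" and Q :: "('n \<times> 'b) set"
  assumes symb_closed: "\<lbrakk>m \<in> carrier M; n \<in> carrier N\<rbrakk> \<Longrightarrow> symb m n \<in> carrier X"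
    and generate_symb: "carrier X = generate X {symb m n | m n. m \<in> carrier M \<and> n \<in> carrier N}"
    and R_subgroup: "subgroup R (M \<times>\<times> E)" and fst_R: "fst ` R = carrier M"
    and Q_subgroup: "subgroup Q (N \<times>\<times> E)" and fst_Q: "fst ` Q = carrier N"
begin

abbreviation "lifts \<equiv> commutator_lifts X E symb R Q"

abbreviation "generating_lifts \<equiv>
  {(symb m n, commutator E x y) | m x n y. (m, x) \<in> R \<and> (n, y) \<in> Q}"

sublocale R: subgroup R "M \<times>\<times> E" by (rule R_subgroup)
sublocale Q: subgroup Q "N \<times>\<times> E" by (rule Q_subgroup)
sublocale XE: group "X \<times>\<times> E" by (rule DirProd_group[OF X.is_group E.is_group])

lemma R_carrier: "(m, x) \<in> R \<Longrightarrow> m \<in> carrier M" "(m, x) \<in> R \<Longrightarrow> x \<in> carrier E"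
  using R.subset by auto

lemma Q_carrier: "(n, y) \<in> Q \<Longrightarrow> n \<in> carrier N" "(n, y) \<in> Q \<Longrightarrow> y \<in> carrier E"
  using Q.subset by auto

lemma R_mult: "(m, x) \<in> R \<Longrightarrow> (m', x') \<in> R \<Longrightarrow> (m \<otimes>\<^bsub>M\<^esub> m', x \<otimes>\<^bsub>E\<^esub> x') \<in> R"
  using R.m_closed by fastforce

lemma Q_mult: "(n, y) \<in> Q \<Longrightarrow> (n', y') \<in> Q \<Longrightarrow> (n \<otimes>\<^bsub>N\<^esub> n', y \<otimes>\<^bsub>E\<^esub> y') \<in> Q"
  using Q.m_closed by fastforce

lemma R_inv: "(m, x) \<in> R \<Longrightarrow> (inv\<^bsub>M\<^esub> m, inv\<^bsub>E\<^esub> x) \<in> R"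
  using R.m_inv_closed[of "(m, x)"] R_carrier
  by (simp add: inv_DirProd[OF M.is_group E.is_group])

lemma Q_inv: "(n, y) \<in> Q \<Longrightarrow> (inv\<^bsub>N\<^esub> n, inv\<^bsub>E\<^esub> y) \<in> Q"
  using Q.m_inv_closed[of "(n, y)"] Q_carrier
  by (simp add: inv_DirProd[OF N.is_group E.is_group])

lemma R_conjugate: "(m, x) \<in> R \<Longrightarrow> (m', x') \<in> R \<Longrightarrow> (conjugate M m m', conjugate E x x') \<in> R"
  by (simp add: conjugate_def R_mult R_inv)

lemma Q_conjugate: "(n, y) \<in> Q \<Longrightarrow> (n', y') \<in> Q \<Longrightarrow> (conjugate N n n', conjugate E y y') \<in> Q"
  by (simp add: conjugate_def Q_mult Q_inv)

lemma R_total: "m \<in> carrier M \<Longrightarrow> \<exists>x. (m, x) \<in> R"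
  using fst_R by force

lemma Q_total: "n \<in> carrier N \<Longrightarrow> \<exists>y. (n, y) \<in> Q"
  using fst_Q by force

lemma generating_lifts_closed: "generating_lifts \<subseteq> carrier (X \<times>\<times> E)"
  by (auto simp: symb_closed R_carrier Q_carrier)

lemma lifts_subgroup: "subgroup lifts (X \<times>\<times> E)"
  unfolding commutator_lifts_def by (rule XE.generate_is_subgroup[OF generating_lifts_closed])

lemma generating_lift_in_lifts: "(m, x) \<in> R \<Longrightarrow> (n, y) \<in> Q \<Longrightarrow> (symb m n, commutator E x y) \<in> lifts"
  unfolding commutator_lifts_def by (blast intro: generate.incl)

lemma fst_lifts: "fst ` lifts = carrier X"
proof -
  interpret fst: group_hom "X \<times>\<times> E" X fst
    by (rule group_homI[OF XE.is_group X.is_group]) (auto simp: hom_def)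
  have "fst ` generating_lifts = {symb m n | m n. m \<in> carrier M \<and> n \<in> carrier N}"
    using R_total Q_total by (force simp: image_iff dest: R_carrier Q_carrier)
  then show ?thesis
    unfolding commutator_lifts_def
    by (simp add: generate_symb flip: fst.generate_img[OF generating_lifts_closed])
qed

lemma snd_lifts: "snd ` lifts = commutator_subgroup E (snd ` R) (snd ` Q)"
proof -
  interpret snd: group_hom "X \<times>\<times> E" E snd
    by (rule group_homI[OF XE.is_group E.is_group]) (auto simp: hom_def)
  have "snd ` generating_lifts = {commutator E x y | x y. x \<in> snd ` R \<and> y \<in> snd ` Q}"
    by (force simp: image_iff)
  then show ?thesis
    unfolding commutator_lifts_def commutator_subgroup_def
    by (simp flip: snd.generate_img[OF generating_lifts_closed])
qed

text \<open>The pairs on which two homomorphisms with a common target agree form a subgroup, so it is enough to look at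
  generators.\<close>

lemma lifts_agree:
  assumes "group K" "h \<in> hom X K" "q \<in> hom E K"
    and "\<And>m x n y. \<lbrakk>(m, x) \<in> R; (n, y) \<in> Q\<rbrakk> \<Longrightarrow> h (symb m n) = q (commutator E x y)"
    and "(t, x) \<in> lifts"
  shows "h t = q x"
proof -
  have "(\<lambda>z. h (fst z)) (t, x) = (\<lambda>z. q (snd z)) (t, x)"
    by (rule hom_agree_on_generate[OF XE.is_group assms(1) _ _ generating_lifts_closed _
          assms(5)[unfolded commutator_lifts_def]])
       (use assms(2-4) in \<open>auto simp: hom_def Pi_iff\<close>)
  then show ?thesis by simp
qed

text \<open>Two values at the same point differ by a value at \<open>1\<close>, and the hypotheses say that such values do not
  affect commutators modulo \<open>S\<close>.\<close>

lemma commutator_coset_unique: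
  assumes S: "S \<lhd> E"
    and left: "\<And>z n y. \<lbrakk>(\<one>\<^bsub>M\<^esub>, z) \<in> R; (n, y) \<in> Q\<rbrakk> \<Longrightarrow> commutator E z y \<in> S"
    and right: "\<And>z m x. \<lbrakk>(m, x) \<in> R; (\<one>\<^bsub>N\<^esub>, z) \<in> Q\<rbrakk> \<Longrightarrow> commutator E x z \<in> S"
    and xy: "(m, x) \<in> R" "(m, x') \<in> R" "(n, y) \<in> Q" "(n, y') \<in> Q"
  shows "S #>\<^bsub>E\<^esub> commutator E x y = S #>\<^bsub>E\<^esub> commutator E x' y'"
proof -
  interpret S: normal S E by (rule S)
  have absorb: "S #>\<^bsub>E\<^esub> (s \<otimes>\<^bsub>E\<^esub> u) = S #>\<^bsub>E\<^esub> u" if "s \<in> S" "u \<in> carrier E" for s u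
    using that E.coset_mult_assoc[OF S.subset S.mem_carrier, of s u]
    by (simp add: S.rcos_const[OF E.is_group])
  have c: "x \<in> carrier E" "x' \<in> carrier E" "y \<in> carrier E" "y' \<in> carrier E"
    using xy R_carrier Q_carrier by blast+
  define z where "z = inv\<^bsub>E\<^esub> x \<otimes>\<^bsub>E\<^esub> x'"
  define w where "w = inv\<^bsub>E\<^esub> y \<otimes>\<^bsub>E\<^esub> y'"
  have zw: "z \<in> carrier E" "w \<in> carrier E" using c by (simp_all add: z_def w_def)
  have "(\<one>\<^bsub>M\<^esub>, z) \<in> R" "(\<one>\<^bsub>N\<^esub>, w) \<in> Q"
    using R_mult[OF R_inv[OF xy(1)] xy(2)] Q_mult[OF Q_inv[OF xy(3)] xy(4)] xy
    by (simp_all add: z_def w_def R_carrier Q_carrier)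
  then have *: "commutator E z y \<in> S" "commutator E x' w \<in> S"
    using left right xy by blast+
  \<comment> \<open>Replace \<open>x\<close> by \<open>x\<close> times \<open>z\<close> first and \<open>y\<close> by \<open>y\<close> times \<open>w\<close> afterwards, each time at the cost of a factor in \<open>S\<close>.\<close>
  have "commutator E x' y = conjugate E x (commutator E z y) \<otimes>\<^bsub>E\<^esub> commutator E x y"
    using c by (simp add: z_def E.free_reduction)
  then have "S #>\<^bsub>E\<^esub> commutator E x' y = S #>\<^bsub>E\<^esub> commutator E x y"
    using absorb E.normal_conjugate[OF S c(1) *(1)] c by simp
  moreover have "commutator E x' y'
      = conjugate E (commutator E x' y \<otimes>\<^bsub>E\<^esub> y) (commutator E x' w) \<otimes>\<^bsub>E\<^esub> commutator E x' y"
    using c by (simp add: w_def E.free_reduction)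
  then have "S #>\<^bsub>E\<^esub> commutator E x' y' = S #>\<^bsub>E\<^esub> commutator E x' y"
    using absorb E.normal_conjugate[OF S _ *(2)] c by simp
  ultimately show ?thesis by simp
qed

text \<open>Modulo \<open>S\<close> the commutator of values is single valued.  The two laws of a crossed pairing then are the
  commutator identities for products, applied to values: \<open>R\<close> and \<open>Q\<close> are multiplicative and compatible
  with the actions, so products and conjugates of values are again values.\<close>

lemma commutator_coset_pairing:
  assumes S: "S \<lhd> E"
    and left: "\<And>z n y. \<lbrakk>(\<one>\<^bsub>M\<^esub>, z) \<in> R; (n, y) \<in> Q\<rbrakk> \<Longrightarrow> commutator E z y \<in> S"
    and right: "\<And>z m x. \<lbrakk>(m, x) \<in> R; (\<one>\<^bsub>N\<^esub>, z) \<in> Q\<rbrakk> \<Longrightarrow> commutator E x z \<in> S"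
    and a: "\<And>m x n y. \<lbrakk>(m, x) \<in> R; (n, y) \<in> Q\<rbrakk> \<Longrightarrow> (a m n, conjugate E x y) \<in> Q"
    and b: "\<And>m x n y. \<lbrakk>(m, x) \<in> R; (n, y) \<in> Q\<rbrakk> \<Longrightarrow> (b n m, conjugate E y x) \<in> R"
  shows "\<exists>c. crossed_pairing M N a b (E Mod S) c \<and>
    (\<forall>m x n y. (m, x) \<in> R \<longrightarrow> (n, y) \<in> Q \<longrightarrow> c (m, n) = S #>\<^bsub>E\<^esub> commutator E x y)"
proof (intro exI conjI allI impI)
  interpret S: normal S E by (rule S)
  let ?c = "\<lambda>(m, n). S #>\<^bsub>E\<^esub> commutator E (SOME x. (m, x) \<in> R) (SOME y. (n, y) \<in> Q)"
  have c: "?c (m, n) = S #>\<^bsub>E\<^esub> commutator E x y" if "(m, x) \<in> R" "(n, y) \<in> Q" for m x n y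
    unfolding case_prod_conv
    using that by (intro commutator_coset_unique[OF S left right]) (auto intro: someI)
  then show "?c (m, n) = S #>\<^bsub>E\<^esub> commutator E x y" if "(m, x) \<in> R" "(n, y) \<in> Q" for m x n y
    using that by blast
  show "crossed_pairing M N a b (E Mod S) ?c"
  proof (rule crossed_pairingI)
    fix m n assume "m \<in> carrier M" "n \<in> carrier N"
    then obtain x y where xy: "(m, x) \<in> R" "(n, y) \<in> Q" using R_total Q_total by blast
    then show "?c (m, n) \<in> carrier (E Mod S)"
      unfolding c[OF xy] by (simp add: carrier_FactGroup R_carrier Q_carrier)
  next
    fix m m' n assume "m \<in> carrier M" "m' \<in> carrier M" "n \<in> carrier N"
    then obtain x x' y where xy: "(m, x) \<in> R" "(m', x') \<in> R" "(n, y) \<in> Q"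
      using R_total Q_total by meson
    then have carr: "x \<in> carrier E" "x' \<in> carrier E" "y \<in> carrier E"
      using R_carrier Q_carrier by blast+
    show "?c (m \<otimes>\<^bsub>M\<^esub> m', n) = ?c (conjugate M m m', a m n) \<otimes>\<^bsub>E Mod S\<^esub> ?c (m, n)"
      unfolding c[OF R_mult[OF xy(1,2)] xy(3)] c[OF xy(1,3)]
        c[OF R_conjugate[OF xy(1,2)] a[OF xy(1,3)]]
      using carr by (simp add: S.rcos_sum E.commutator_mult_left)
  next
    fix m n n' assume "m \<in> carrier M" "n \<in> carrier N" "n' \<in> carrier N"
    then obtain x y y' where xy: "(m, x) \<in> R" "(n, y) \<in> Q" "(n', y') \<in> Q"
      using R_total Q_total by meson
    then have carr: "x \<in> carrier E" "y \<in> carrier E" "y' \<in> carrier E"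
      using R_carrier Q_carrier by blast+
    show "?c (m, n \<otimes>\<^bsub>N\<^esub> n') = ?c (m, n) \<otimes>\<^bsub>E Mod S\<^esub> ?c (b n m, conjugate N n n')"
      unfolding c[OF xy(1) Q_mult[OF xy(2,3)]] c[OF xy(1,2)]
        c[OF b[OF xy(1,2)] Q_conjugate[OF xy(2,3)]]
      using carr by (simp add: S.rcos_sum E.commutator_mult_right)
  qed
qed

text \<open>A homomorphism that induces commutators modulo \<open>S\<close> on symbols has a graph that contains all lifts modulo
  \<open>S\<close>; over \<open>1\<close> it contains only the trivial coset.\<close>

lemma lifts_of_one:
  assumes S: "S \<lhd> E" and h: "h \<in> hom X (E Mod S)"
    and symb: "\<And>m x n y. \<lbrakk>(m, x) \<in> R; (n, y) \<in> Q\<rbrakk> \<Longrightarrow> h (symb m n) = S #>\<^bsub>E\<^esub> commutator E x y"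
    and u: "(\<one>\<^bsub>X\<^esub>, u) \<in> lifts"
  shows "u \<in> S"
proof -
  interpret S: normal S E by (rule S)
  have "h \<one>\<^bsub>X\<^esub> = S #>\<^bsub>E\<^esub> u"
    by (rule lifts_agree[OF S.factorgroup_is_group h S.r_coset_hom_Mod symb u])
  moreover have "h \<one>\<^bsub>X\<^esub> = S"
    using hom_one[OF h X.is_group S.factorgroup_is_group] by simp
  moreover have "u \<in> carrier E"
    using u subgroup.subset[OF lifts_subgroup] by auto
  ultimately show ?thesis
    using E.rcos_self[OF _ S.subgroup_axioms] by blast
qed

end


section \<open>Lifts along an epimorphism\<close>

locale group_epimorphism = E: group E + G: group G
  for E :: "'b monoid" and G :: "'a monoid" +
  fixes p :: "'b \<Rightarrow> 'a"
  assumes p_epi: "p \<in> epi E G"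
begin

lemma p_hom: "p \<in> hom E G" and p_surj: "p ` carrier E = carrier G"
  using p_epi by (auto simp: epi_def)

sublocale p: group_hom E G p
  by (rule group_homI[OF E.is_group G.is_group p_hom])

text \<open>Index \<open>k\<close> belongs to the power with index \<open>k + 1\<close>, as for the stages.  Each set is the image of the
  corresponding power of \<open>E\<close> under the map induced by \<open>p\<close>, paired with the commutator map into \<open>E\<close>.\<close>

primrec tensor_lifts :: "nat \<Rightarrow> ('a tensor_elt \<times> 'b) set" where
  "tensor_lifts 0 = (\<lambda>x. (Tensor_Base (p x), x)) ` carrier E"
| "tensor_lifts (Suc k) = commutator_lifts (stage_group (tensor_stages G (Suc k))) E
     (next_symbol G (tensor_stages G k)) (tensor_lifts k) ((\<lambda>y. (p y, y)) ` carrier E)"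

primrec wedge_lifts :: "nat \<Rightarrow> ('a wedge_elt \<times> 'b) set" where
  "wedge_lifts 0 = (\<lambda>x. (Wedge_Base (p x), x)) ` carrier E"
| "wedge_lifts (Suc k) = commutator_lifts (wedge_stage G (Suc k)) E
     (next_wedge_symbol (wedge_stage G k)) (wedge_lifts k) (wedge_lifts k)"

lemma graph_subgroup:
  assumes "group K" "h \<in> hom E K"
  shows "subgroup ((\<lambda>x. (h x, x)) ` carrier E) (K \<times>\<times> E)"
proof -
  interpret group_hom E "K \<times>\<times> E" "\<lambda>x. (h x, x)"
    by (rule group_homI[OF E.is_group DirProd_group[OF assms(1) E.is_group]])
       (use assms(2) in \<open>auto simp: hom_def Pi_iff\<close>)
  show ?thesis by (rule img_is_subgroup)
qed

lemma crossed_stage_G: "crossed_stage G (tensor_stages G k)"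
  by (rule crossed_stage_tensor_stages[OF G.is_group])

lemma tensor_lift_step:
  assumes "subgroup (tensor_lifts k) (stage_group (tensor_stages G k) \<times>\<times> E)"
    and "fst ` tensor_lifts k = carrier (stage_group (tensor_stages G k))"
  shows "lift_step (stage_group (tensor_stages G k)) G (stage_group (tensor_stages G (Suc k))) E
    (next_symbol G (tensor_stages G k)) (tensor_lifts k) ((\<lambda>y. (p y, y)) ` carrier E)"
proof -
  interpret S: crossed_stage G "tensor_stages G k" by (rule crossed_stage_G)
  show ?thesis
    using assms S.generate_next_stage S.next_symbol_closed graph_subgroup[OF G.is_group p_hom] p_surj
    by (intro lift_step.intro lift_step_axioms.intro S.group_stage G.is_group E.is_group)
       (simp_all add: S.group_next_stage image_image)
qed

lemma tensor_lifts:
  shows tensor_lifts_subgroup: "subgroup (tensor_lifts k) (stage_group (tensor_stages G k) \<times>\<times> E)"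
    and fst_tensor_lifts: "fst ` tensor_lifts k = carrier (stage_group (tensor_stages G k))"
    and snd_tensor_lifts: "snd ` tensor_lifts k = lower_central E (Suc k)"
proof -
  have "subgroup (tensor_lifts k) (stage_group (tensor_stages G k) \<times>\<times> E) \<and>
    fst ` tensor_lifts k = carrier (stage_group (tensor_stages G k)) \<and>
    snd ` tensor_lifts k = lower_central E (Suc k)"
  proof (induction k)
    case 0
    have "inj Tensor_Base" by (rule injI) simp
    note base = image_group_base[OF G.is_group this]
    have "(\<lambda>x. Tensor_Base (p x)) \<in> hom E (image_group Tensor_Base G)"
      by (auto simp: hom_def image_group_carrier base)
    from graph_subgroup[OF base(2) this] show ?case
      using p_surj by (auto simp: image_image image_group_carrier lower_central_1)
  next
    case (Suc k)
    interpret lift_step "stage_group (tensor_stages G k)" G "stage_group (tensor_stages G (Suc k))" E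
        "next_symbol G (tensor_stages G k)" "tensor_lifts k" "(\<lambda>y. (p y, y)) ` carrier E"
      using Suc by (intro tensor_lift_step) auto
    show ?case
      using lifts_subgroup fst_lifts snd_lifts Suc
      by (simp add: image_image lower_central_Suc)
  qed
  then show "subgroup (tensor_lifts k) (stage_group (tensor_stages G k) \<times>\<times> E)"
    "fst ` tensor_lifts k = carrier (stage_group (tensor_stages G k))"
    "snd ` tensor_lifts k = lower_central E (Suc k)"
    by auto
qed

lemmas lift_step_tensor = tensor_lift_step[OF tensor_lifts_subgroup fst_tensor_lifts]

lemma tensor_lifts_over_lambda:
  "(t, x) \<in> tensor_lifts k \<Longrightarrow> p x = stage_lambda (tensor_stages G k) t"
proof (induction k arbitrary: t x)
  case (Suc k)
  interpret S: crossed_stage G "tensor_stages G k" by (rule crossed_stage_G)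
  interpret lift_step "stage_group (tensor_stages G k)" G "stage_group (tensor_stages G (Suc k))" E
      "next_symbol G (tensor_stages G k)" "tensor_lifts k" "(\<lambda>y. (p y, y)) ` carrier E"
    by (rule lift_step_tensor)
  have "stage_lambda (tensor_stages G (Suc k)) t = p x"
    by (rule lifts_agree[OF G.is_group _ p_hom _ Suc.prems[unfolded tensor_lifts.simps]])
       (use S.next_lambda_hom in
         \<open>auto simp: S.next_lambda_symbol R_carrier Suc.IH[symmetric] p.hom_commutator\<close>)
  then show ?case by simp
qed auto

text \<open>The action of \<open>G\<close> on a tensor power corresponds to conjugation of the values by preimages in \<open>E\<close>.
  This is the compatibility with the action on the left factor that the next pairing needs.\<close>

lemma tensor_lifts_equivariant:
  assumes y: "y \<in> carrier E"
  shows "(t, x) \<in> tensor_lifts k \<Longrightarrow>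
    (stage_act (tensor_stages G k) (p y) t, conjugate E y x) \<in> tensor_lifts k"
proof (induction k arbitrary: t x)
  case 0
  then show ?case using y by (auto simp flip: p.hom_conjugate)
next
  case (Suc k)
  interpret S: crossed_stage G "tensor_stages G k" by (rule crossed_stage_G)
  interpret lift_step "stage_group (tensor_stages G k)" G "stage_group (tensor_stages G (Suc k))" E
      "next_symbol G (tensor_stages G k)" "tensor_lifts k" "(\<lambda>y. (p y, y)) ` carrier E"
    by (rule lift_step_tensor)
  let ?X = "stage_group (tensor_stages G (Suc k))"
  let ?h = "\<lambda>(t, x). (stage_act (tensor_stages G (Suc k)) (p y) t, conjugate E y x)"
  have py: "p y \<in> carrier G" using y by simp
  have "?h \<in> hom (?X \<times>\<times> E) (?X \<times>\<times> E)"
    using S.next_act_hom[OF py] E.conjugate_hom[OF y] by (auto simp: hom_def Pi_iff)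
  then have hom: "group_hom (?X \<times>\<times> E) (?X \<times>\<times> E) ?h"
    by (rule group_homI[OF XE.is_group XE.is_group])
  have "?h ` generating_lifts \<subseteq> lifts"
  proof (rule image_subsetI)
    fix z assume "z \<in> generating_lifts"
    then obtain m x g v where z: "z = (next_symbol G (tensor_stages G k) m g, commutator E x v)"
      and R: "(m, x) \<in> tensor_lifts k" and Q: "(g, v) \<in> (\<lambda>y. (p y, y)) ` carrier E" by blast
    have "(conjugate G (p y) g, conjugate E y v) \<in> (\<lambda>y. (p y, y)) ` carrier E"
      using Q y by (auto simp flip: p.hom_conjugate)
    from generating_lift_in_lifts[OF Suc.IH[OF R] this] show "?h z \<in> lifts"
      using R Q y py z
      by (auto simp: S.next_act_symbol R_carrier E.conjugate_commutator)
  qed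
  from hom_generate_into_subgroup[OF hom lifts_subgroup generating_lifts_closed this
      Suc.prems[unfolded tensor_lifts.simps commutator_lifts_def]]
  show ?case by simp
qed

text \<open>On a symbol \<open>t \<otimes> x\<close> over \<open>\<Gamma>\<close>, the commutator of the value \<open>f' (\<lambda> t)\<close> with the preimage \<open>f' x\<close> of \<open>f x\<close> is the image
  under \<open>f'\<close> of \<open>[\<lambda> t, x]\<close>.  The kernel of \<open>\<lambda>\<close> over \<open>\<Gamma>\<close> therefore is sent to points where \<open>1\<close> is
  a value.\<close>

lemma tensor_lifts_natural:
  fixes \<Gamma> :: "'c monoid"
  assumes \<Gamma>: "group \<Gamma>" and f': "f' \<in> hom \<Gamma> E" and f: "group_hom \<Gamma> G f"
    and f'_lift: "\<And>x. x \<in> carrier \<Gamma> \<Longrightarrow> p (f' x) = f x"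
  shows "t \<in> carrier (stage_group (tensor_stages \<Gamma> k)) \<Longrightarrow>
    (tensor_stage_map \<Gamma> G f k t, f' (stage_lambda (tensor_stages \<Gamma> k) t)) \<in> tensor_lifts k"
proof (induction k arbitrary: t)
  case 0
  then show ?case
    using f'_lift hom_in_carrier[OF f'] by (auto simp: image_group_carrier intro!: image_eqI)
next
  case (Suc k)
  interpret f': group_hom \<Gamma> E f' by (rule group_homI[OF \<Gamma> E.is_group f'])
  interpret S: crossed_stage G "tensor_stages G k" by (rule crossed_stage_G)
  interpret S\<Gamma>: crossed_stage \<Gamma> "tensor_stages \<Gamma> k" by (rule crossed_stage_tensor_stages[OF \<Gamma>])
  interpret lift_step "stage_group (tensor_stages G k)" G "stage_group (tensor_stages G (Suc k))" E
      "next_symbol G (tensor_stages G k)" "tensor_lifts k" "(\<lambda>y. (p y, y)) ` carrier E"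
    by (rule lift_step_tensor)
  let ?T = "stage_group (next_stage \<Gamma> (tensor_stages \<Gamma> k))"
  let ?X = "stage_group (tensor_stages G (Suc k))"
  let ?h = "\<lambda>t. (tensor_stage_map \<Gamma> G f (Suc k) t,
    f' (stage_lambda (next_stage \<Gamma> (tensor_stages \<Gamma> k)) t))"
  let ?symbols = "{next_symbol \<Gamma> (tensor_stages \<Gamma> k) t x | t x.
    t \<in> carrier (stage_group (tensor_stages \<Gamma> k)) \<and> x \<in> carrier \<Gamma>}"
  have "?h \<in> hom ?T (?X \<times>\<times> E)"
    using tensor_stage_map(1)[OF f, of "Suc k"]
      Group.hom_compose[OF S\<Gamma>.next_lambda_hom f'] by (simp add: hom_def Pi_iff)
  then have hom: "group_hom ?T (?X \<times>\<times> E) ?h"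
    by (rule group_homI[OF S\<Gamma>.group_next_stage XE.is_group])
  have "?h ` ?symbols \<subseteq> lifts"
  proof (rule image_subsetI)
    fix z assume "z \<in> ?symbols"
    then obtain t x where z: "z = next_symbol \<Gamma> (tensor_stages \<Gamma> k) t x"
      and t: "t \<in> carrier (stage_group (tensor_stages \<Gamma> k))" and x: "x \<in> carrier \<Gamma>" by blast
    have "(f x, f' x) \<in> (\<lambda>y. (p y, y)) ` carrier E"
      using x f'_lift by (auto intro!: image_eqI[of _ _ "f' x"])
    from generating_lift_in_lifts[OF Suc.IH[OF t] this] show "?h z \<in> lifts"
      unfolding z S\<Gamma>.next_lambda_symbol[OF t x] tensor_stage_map(4)[OF f t x]
      using t x by (simp add: f'.hom_commutator)
  qed
  moreover have "?symbols \<subseteq> carrier ?T" by (auto simp: S\<Gamma>.next_symbol_closed)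
  ultimately have "?h t \<in> lifts"
    using hom_generate_into_subgroup[OF hom lifts_subgroup] Suc.prems
    by (simp add: S\<Gamma>.generate_next_stage)
  then show ?case by simp
qed

text \<open>The ambiguity of values shrinks along the upper central series.  In the induction step, a value at \<open>1\<close> on the
  left lies in \<open>Z\<^sub>N\<^sub>-\<^sub>k\<close>, whose commutators with \<open>E\<close> lie in the next term, and a value at \<open>1\<close> on the
  right lies in the kernel of \<open>p\<close>, which commutes with \<open>\<gamma>\<^sub>k\<^sub>+\<^sub>1(E)\<close> modulo the next term.\<close>

lemma tensor_lifts_of_one:
  assumes ker: "kernel E G p \<subseteq> upper_central E N"
  shows "k \<le> N \<Longrightarrow> (\<one>\<^bsub>stage_group (tensor_stages G k)\<^esub>, u) \<in> tensor_lifts k \<Longrightarrow>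
    u \<in> upper_central E (N - k)"
proof (induction k arbitrary: u)
  case 0
  then show ?case using ker by (auto simp: image_group_one kernel_def)
next
  case (Suc k)
  interpret S: crossed_stage G "tensor_stages G k" by (rule crossed_stage_G)
  interpret lift_step "stage_group (tensor_stages G k)" G "stage_group (tensor_stages G (Suc k))" E
      "next_symbol G (tensor_stages G k)" "tensor_lifts k" "(\<lambda>y. (p y, y)) ` carrier E"
    by (rule lift_step_tensor)
  let ?Z = "upper_central E (N - Suc k)"
  have left: "commutator E z y \<in> ?Z"
    if "(\<one>\<^bsub>stage_group (tensor_stages G k)\<^esub>, z) \<in> tensor_lifts k"
      "(g, y) \<in> (\<lambda>y. (p y, y)) ` carrier E" for z g y
  proof -
    have "z \<in> upper_central E (Suc (N - Suc k))"
      using Suc.IH[OF _ that(1)] Suc.prems(1) by (simp add: Suc_diff_Suc del: upper_central.simps)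
    then show ?thesis using that by auto
  qed
  have right: "commutator E x z \<in> ?Z"
    if "(t, x) \<in> tensor_lifts k" "(\<one>\<^bsub>G\<^esub>, z) \<in> (\<lambda>y. (p y, y)) ` carrier E" for z t x
  proof (rule E.lower_central_commutes_with_upper_central)
    show "x \<in> lower_central E (Suc k)"
      using that(1) snd_tensor_lifts by force
    have "z \<in> upper_central E N" using that(2) ker by (auto simp: kernel_def)
    then show "z \<in> upper_central E (N - Suc k + Suc k)" using Suc.prems(1) by simp
  qed
  have a: "(stage_act_back G (tensor_stages G k) t g, conjugate E x y)
      \<in> (\<lambda>y. (p y, y)) ` carrier E"
    if "(t, x) \<in> tensor_lifts k" "(g, y) \<in> (\<lambda>y. (p y, y)) ` carrier E" for t x g y
    using that R_carrier(2)[OF that(1)]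
    by (auto simp: stage_act_back_def simp flip: tensor_lifts_over_lambda p.hom_conjugate)
  have b: "(stage_act (tensor_stages G k) g t, conjugate E y x) \<in> tensor_lifts k"
    if "(t, x) \<in> tensor_lifts k" "(g, y) \<in> (\<lambda>y. (p y, y)) ` carrier E" for t x g y
    using that tensor_lifts_equivariant by auto
  have Z: "?Z \<lhd> E" by (rule E.upper_central_normal)
  have "\<exists>c. S.stage_pairing (E Mod ?Z) c \<and>
      (\<forall>t x g y. (t, x) \<in> tensor_lifts k \<longrightarrow> (g, y) \<in> (\<lambda>y. (p y, y)) ` carrier E \<longrightarrow>
        c (t, g) = ?Z #>\<^bsub>E\<^esub> commutator E x y)"
    by (rule commutator_coset_pairing[OF Z]) (erule (1) left right a b)+
  then obtain c where c: "S.stage_pairing (E Mod ?Z) c"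
    "\<forall>t x g y. (t, x) \<in> tensor_lifts k \<longrightarrow> (g, y) \<in> (\<lambda>y. (p y, y)) ` carrier E \<longrightarrow>
      c (t, g) = ?Z #>\<^bsub>E\<^esub> commutator E x y"
    by (elim exE conjE)
  note lift = S.next_lift[OF normal.factorgroup_is_group[OF Z] c(1)]
  show ?case
  proof (rule lifts_of_one[OF Z _ _ Suc.prems(2)[unfolded tensor_lifts.simps]])
    show "next_lift G (tensor_stages G k) (E Mod ?Z) c
        \<in> hom (stage_group (tensor_stages G (Suc k))) (E Mod ?Z)"
      using lift(1) by simp
    show "next_lift G (tensor_stages G k) (E Mod ?Z) c (next_symbol G (tensor_stages G k) t g)
        = ?Z #>\<^bsub>E\<^esub> commutator E x y"
      if "(t, x) \<in> tensor_lifts k" "(g, y) \<in> (\<lambda>y. (p y, y)) ` carrier E" for t x g y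
      using lift(2)[OF R_carrier(1)[OF that(1)] Q_carrier(1)[OF that(2)]]
        c(2)[rule_format, OF that] by simp
  qed
qed

lemma wedge_lift_step:
  assumes "subgroup (wedge_lifts k) (wedge_stage G k \<times>\<times> E)"
    and "fst ` wedge_lifts k = carrier (wedge_stage G k)"
  shows "lift_step (wedge_stage G k) (wedge_stage G k) (wedge_stage G (Suc k)) E
    (next_wedge_symbol (wedge_stage G k)) (wedge_lifts k) (wedge_lifts k)"
proof -
  interpret S: wedge_step "wedge_stage G k"
    by (rule wedge_step.intro[OF group_wedge_stage[OF G.is_group]])
  show ?thesis
    using assms S.generate_next_wedge S.next_wedge_symbol_closed
    by (intro lift_step.intro lift_step_axioms.intro group_wedge_stage[OF G.is_group] E.is_group)
       simp_all
qed

lemma wedge_lifts: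
  shows wedge_lifts_subgroup: "subgroup (wedge_lifts k) (wedge_stage G k \<times>\<times> E)"
    and fst_wedge_lifts: "fst ` wedge_lifts k = carrier (wedge_stage G k)"
    and snd_wedge_lifts: "snd ` wedge_lifts k = derived_series E (Suc k)"
proof -
  have "subgroup (wedge_lifts k) (wedge_stage G k \<times>\<times> E) \<and>
    fst ` wedge_lifts k = carrier (wedge_stage G k) \<and>
    snd ` wedge_lifts k = derived_series E (Suc k)"
  proof (induction k)
    case 0
    have "inj Wedge_Base" by (rule injI) simp
    note base = image_group_base[OF G.is_group this]
    have "(\<lambda>x. Wedge_Base (p x)) \<in> hom E (image_group Wedge_Base G)"
      by (auto simp: hom_def image_group_carrier base)
    from graph_subgroup[OF base(2) this] show ?case
      using p_surj by (auto simp: image_image image_group_carrier derived_series_1)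
  next
    case (Suc k)
    interpret lift_step "wedge_stage G k" "wedge_stage G k" "wedge_stage G (Suc k)" E
        "next_wedge_symbol (wedge_stage G k)" "wedge_lifts k" "wedge_lifts k"
      using Suc by (intro wedge_lift_step) auto
    show ?case
      using lifts_subgroup fst_lifts snd_lifts Suc by (simp add: derived_series_Suc)
  qed
  then show "subgroup (wedge_lifts k) (wedge_stage G k \<times>\<times> E)"
    "fst ` wedge_lifts k = carrier (wedge_stage G k)"
    "snd ` wedge_lifts k = derived_series E (Suc k)"
    by auto
qed

lemmas lift_step_wedge = wedge_lift_step[OF wedge_lifts_subgroup fst_wedge_lifts]

lemma wedge_lifts_over_mu: "(t, x) \<in> wedge_lifts k \<Longrightarrow> p x = wedge_stage_mu G k t"
proof (induction k arbitrary: t x)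
  case (Suc k)
  interpret lift_step "wedge_stage G k" "wedge_stage G k" "wedge_stage G (Suc k)" E
      "next_wedge_symbol (wedge_stage G k)" "wedge_lifts k" "wedge_lifts k"
    by (rule lift_step_wedge)
  have "wedge_stage_mu G (Suc k) t = p x"
    by (rule lifts_agree[OF G.is_group wedge_mu_hom[OF G.is_group] p_hom _
          Suc.prems[unfolded wedge_lifts.simps]])
       (simp add: wedge_mu_symbol[OF G.is_group] R_carrier Suc.IH[symmetric] p.hom_commutator
          del: wedge_stage_mu.simps)
  then show ?case by simp
qed auto

lemma wedge_lifts_natural:
  fixes \<Gamma> :: "'c monoid"
  assumes \<Gamma>: "group \<Gamma>" and f': "f' \<in> hom \<Gamma> E" and f: "group_hom \<Gamma> G f"
    and f'_lift: "\<And>x. x \<in> carrier \<Gamma> \<Longrightarrow> p (f' x) = f x"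
  shows "t \<in> carrier (wedge_stage \<Gamma> k) \<Longrightarrow>
    (wedge_stage_map \<Gamma> G f k t, f' (wedge_stage_mu \<Gamma> k t)) \<in> wedge_lifts k"
proof (induction k arbitrary: t)
  case 0
  then show ?case
    using f'_lift hom_in_carrier[OF f'] by (auto simp: image_group_carrier intro!: image_eqI)
next
  case (Suc k)
  interpret f': group_hom \<Gamma> E f' by (rule group_homI[OF \<Gamma> E.is_group f'])
  interpret S\<Gamma>: wedge_step "wedge_stage \<Gamma> k" by (rule wedge_step.intro[OF group_wedge_stage[OF \<Gamma>]])
  interpret lift_step "wedge_stage G k" "wedge_stage G k" "wedge_stage G (Suc k)" E
      "next_wedge_symbol (wedge_stage G k)" "wedge_lifts k" "wedge_lifts k"
    by (rule lift_step_wedge)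
  let ?h = "\<lambda>t. (wedge_stage_map \<Gamma> G f (Suc k) t, f' (wedge_stage_mu \<Gamma> (Suc k) t))"
  let ?symbols = "{next_wedge_symbol (wedge_stage \<Gamma> k) a b | a b.
    a \<in> carrier (wedge_stage \<Gamma> k) \<and> b \<in> carrier (wedge_stage \<Gamma> k)}"
  have "?h \<in> hom (wedge_stage \<Gamma> (Suc k)) (wedge_stage G (Suc k) \<times>\<times> E)"
    using wedge_stage_map(1)[OF f, of "Suc k"]
      Group.hom_compose[OF wedge_mu_hom[OF \<Gamma>, of "Suc k"] f']
    by (simp add: hom_def Pi_iff del: wedge_stage_mu.simps wedge_stage.simps wedge_stage_map.simps)
  then have hom: "group_hom (wedge_stage \<Gamma> (Suc k)) (wedge_stage G (Suc k) \<times>\<times> E) ?h"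
    by (rule group_homI[OF group_wedge_stage[OF \<Gamma>] XE.is_group])
  have "?h ` ?symbols \<subseteq> lifts"
  proof (rule image_subsetI)
    fix z assume "z \<in> ?symbols"
    then obtain a b where z: "z = next_wedge_symbol (wedge_stage \<Gamma> k) a b"
      and ab: "a \<in> carrier (wedge_stage \<Gamma> k)" "b \<in> carrier (wedge_stage \<Gamma> k)" by blast
    from generating_lift_in_lifts[OF Suc.IH[OF ab(1)] Suc.IH[OF ab(2)]] show "?h z \<in> lifts"
      unfolding z wedge_mu_symbol[OF \<Gamma> ab] wedge_stage_map(2)[OF f ab]
      using ab hom_in_carrier[OF wedge_mu_hom[OF \<Gamma>]] by (simp add: f'.hom_commutator)
  qed
  moreover have "?symbols \<subseteq> carrier (wedge_stage \<Gamma> (Suc k))"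
    by (auto simp: S\<Gamma>.next_wedge_symbol_closed)
  moreover have "t \<in> generate (wedge_stage \<Gamma> (Suc k)) ?symbols"
    using Suc.prems S\<Gamma>.generate_next_wedge by simp
  ultimately have "?h t \<in> lifts"
    using hom_generate_into_subgroup[OF hom lifts_subgroup] by blast
  then show ?case by simp
qed

text \<open>Both factors are treated alike here: a value at \<open>1\<close> lies in the \<open>k\<close>-th term of the chain, whose commutators
  with \<open>\<Gamma>\<^sub>k\<^sub>+\<^sub>1(E)\<close>, which contains all values, lie in the next one.  The pairing is alternating since
  \<open>[x, x] = 1\<close>.\<close>

lemma wedge_lifts_of_one:
  assumes ker: "kernel E G p \<subseteq> annihilator_term E N 0"
  shows "k \<le> N \<Longrightarrow> (\<one>\<^bsub>wedge_stage G k\<^esub>, u) \<in> wedge_lifts k \<Longrightarrow>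
    u \<in> annihilator_term E (N - k) k"
proof (induction k arbitrary: u)
  case 0
  then show ?case using ker by (auto simp: image_group_one kernel_def)
next
  case (Suc k)
  interpret S: wedge_step "wedge_stage G k"
    by (rule wedge_step.intro[OF group_wedge_stage[OF G.is_group]])
  interpret lift_step "wedge_stage G k" "wedge_stage G k" "wedge_stage G (Suc k)" E
      "next_wedge_symbol (wedge_stage G k)" "wedge_lifts k" "wedge_lifts k"
    by (rule lift_step_wedge)
  let ?V = "annihilator_term E (N - Suc k) (Suc k)"
  have V: "?V \<lhd> E" by (rule E.annihilator_term_normal)
  interpret V: normal ?V E by (rule V)
  have left: "commutator E z y \<in> ?V"
    if "(\<one>\<^bsub>wedge_stage G k\<^esub>, z) \<in> wedge_lifts k" "(b, y) \<in> wedge_lifts k" for z b y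
  proof -
    have "z \<in> annihilator_term E (Suc (N - Suc k)) k"
      using Suc.IH[OF _ that(1)] Suc.prems(1) by (simp add: Suc_diff_Suc del: annihilator_term.simps)
    moreover have "y \<in> derived_series E (Suc k)" using that(2) snd_wedge_lifts by force
    ultimately show ?thesis by simp
  qed
  have right: "commutator E x z \<in> ?V"
    if "(a, x) \<in> wedge_lifts k" "(\<one>\<^bsub>wedge_stage G k\<^esub>, z) \<in> wedge_lifts k" for z a x
    using V.m_inv_closed[OF left[OF that(2,1)]] E.commutator_flip[of x z]
      R_carrier(2)[OF that(1)] R_carrier(2)[OF that(2)] by simp
  have "\<exists>c. crossed_pairing (wedge_stage G k) (wedge_stage G k) (conjugate (wedge_stage G k))
      (conjugate (wedge_stage G k)) (E Mod ?V) c \<and>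
      (\<forall>a x b y. (a, x) \<in> wedge_lifts k \<longrightarrow> (b, y) \<in> wedge_lifts k \<longrightarrow>
        c (a, b) = ?V #>\<^bsub>E\<^esub> commutator E x y)"
    by (rule commutator_coset_pairing[OF V]) (erule (1) left right R_conjugate)+
  then obtain c where c: "crossed_pairing (wedge_stage G k) (wedge_stage G k)
      (conjugate (wedge_stage G k)) (conjugate (wedge_stage G k)) (E Mod ?V) c"
    "\<forall>a x b y. (a, x) \<in> wedge_lifts k \<longrightarrow> (b, y) \<in> wedge_lifts k \<longrightarrow>
      c (a, b) = ?V #>\<^bsub>E\<^esub> commutator E x y"
    by (elim exE conjE)
  have "c (a, a) = \<one>\<^bsub>E Mod ?V\<^esub>" if a: "a \<in> carrier (wedge_stage G k)" for a
  proof -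
    obtain x where x: "(a, x) \<in> wedge_lifts k" using R_total[OF a] by blast
    then show ?thesis
      using R_carrier(2)[OF x] V.subset by (simp add: c(2)[rule_format, OF x x] E.commutator_self)
  qed
  with c(1) have "alternating_pairing (wedge_stage G k) (E Mod ?V) c"
    by (simp add: alternating_pairing_def)
  note lift = S.next_wedge_lift[OF V.factorgroup_is_group this]
  show ?case
  proof (rule lifts_of_one[OF V _ _ Suc.prems(2)[unfolded wedge_lifts.simps]])
    show "next_wedge_lift (wedge_stage G k) (E Mod ?V) c \<in> hom (wedge_stage G (Suc k)) (E Mod ?V)"
      using lift(1) by simp
    show "next_wedge_lift (wedge_stage G k) (E Mod ?V) c (next_wedge_symbol (wedge_stage G k) a b)
        = ?V #>\<^bsub>E\<^esub> commutator E x y"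
      if "(a, x) \<in> wedge_lifts k" "(b, y) \<in> wedge_lifts k" for a x b y
      using lift(2)[OF R_carrier(1)[OF that(1)] Q_carrier(1)[OF that(2)]]
        c(2)[rule_format, OF that] by simp
  qed
qed

end


section \<open>Classes of groups closed under quotients and extensions\<close>

lemma closed_group_classD:
  assumes "closed_group_class P"
  shows "P H \<Longrightarrow> group H"
    and "\<lbrakk>P H; group K; h \<in> epi H K\<rbrakk> \<Longrightarrow> P K"
    and "\<lbrakk>P A; P B; short_exact_sequence B E A q i\<rbrakk> \<Longrightarrow> P E"
  using assms unfolding closed_group_class_def by blast+

text \<open>The class is closed under quotients whose elements lie in the universe; a section of the quotient map provides
  a copy of the quotient there.\<close>

lemma closed_group_class_quotient:
  assumes P: "closed_group_class P" and H: "in_group_class P H" "group H" and K: "group K"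
    and h: "h \<in> epi H K"
  shows "in_group_class P K"
proof -
  obtain H0 \<phi> where H0: "P H0" "\<phi> \<in> iso H H0"
    using H by (auto simp: in_group_class_def is_iso_def)
  let ?\<psi> = "inv_into (carrier H) \<phi>"
  have \<psi>: "?\<psi> \<in> iso H0 H" using group.iso_set_sym[OF H(2) H0(2)] .
  define k where "k = h \<circ> ?\<psi>"
  have k_hom: "k \<in> hom H0 K"
    unfolding k_def using Group.hom_compose[of ?\<psi> H0 H h K] \<psi> h by (simp add: iso_def epi_def)
  have k_img: "k ` carrier H0 = carrier K"
    unfolding k_def image_comp[symmetric] using \<psi> h by (simp add: iso_def bij_betw_def epi_def)
  let ?s = "inv_into (carrier H0) k"
  have s: "inj_on ?s (carrier K)" using k_img by (intro inj_on_inv_into) simp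
  let ?K0 = "image_group ?s K"
  have iso: "?s \<in> iso K ?K0" by (rule inj_imp_image_group_iso[OF s])
  have "group ?K0" by (rule group_image_group[OF K s])
  moreover have "?s \<circ> k \<in> epi H0 ?K0"
    unfolding epi_def
  proof (intro CollectI conjI)
    show "?s \<circ> k \<in> hom H0 ?K0"
      by (rule Group.hom_compose[OF k_hom iso_imp_homomorphism[OF iso]])
    show "(?s \<circ> k) ` carrier H0 = carrier ?K0"
      unfolding image_comp[symmetric] by (simp add: k_img image_group_carrier)
  qed
  ultimately have "P ?K0"
    by (rule closed_group_classD(2)[OF P H0(1)])
  then show ?thesis using iso by (auto simp: in_group_class_def is_iso_def)
qed

text \<open>A section of \<open>h\<close> embeds \<open>E\<close> as a set into the product of kernel and quotient, hence into the square of
  the universe, which is equipotent to the universe because this is infinite.\<close>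

lemma closed_group_class_extension:
  fixes P :: "'u monoid \<Rightarrow> bool"
  assumes P: "closed_group_class P" and inf: "infinite (UNIV :: 'u set)"
    and E: "group E" and B: "group B" and h: "h \<in> epi E B"
    and ker: "in_group_class P (E\<lparr>carrier := kernel E B h\<rparr>)" and quot: "in_group_class P B"
  shows "in_group_class P E"
proof -
  let ?C = "E\<lparr>carrier := kernel E B h\<rparr>"
  interpret h: group_hom E B h using E B h by (intro group_homI) (auto simp: epi_def)
  obtain A0 \<alpha> where A0: "P A0" "\<alpha> \<in> iso ?C A0"
    using ker by (auto simp: in_group_class_def is_iso_def)
  obtain B0 \<beta> where B0: "P B0" "\<beta> \<in> iso B B0"
    using quot by (auto simp: in_group_class_def is_iso_def)
  have "group A0" "group B0" using closed_group_classD(1)[OF P] A0(1) B0(1) by blast+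
  have "group ?C" by (rule h.G.subgroup_imp_group[OF h.subgroup_kernel])
  have inj: "inj_on \<alpha> (kernel E B h)" "inj_on \<beta> (carrier B)"
    using A0 B0 by (auto simp: iso_def bij_betw_def)
  define s where "s b = inv_into (carrier E) h b" for b
  have s: "s b \<in> carrier E" "h (s b) = b" if "b \<in> carrier B" for b
    using that h by (auto simp: s_def epi_def inv_into_into f_inv_into_f)
  define pair where "pair x = (\<alpha> (x \<otimes>\<^bsub>E\<^esub> inv\<^bsub>E\<^esub> s (h x)), \<beta> (h x))" for x
  have pair: "inj_on pair (carrier E)"
  proof (rule inj_onI)
    fix x y assume xy: "x \<in> carrier E" "y \<in> carrier E" "pair x = pair y"
    then have hxy: "h x = h y" using inj(2) by (auto simp: pair_def inj_on_def)
    have "z \<otimes>\<^bsub>E\<^esub> inv\<^bsub>E\<^esub> s (h z) \<in> kernel E B h" if "z \<in> carrier E" for z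
      using that s[of "h z"] by (simp add: kernel_def)
    then have "x \<otimes>\<^bsub>E\<^esub> inv\<^bsub>E\<^esub> s (h x) = y \<otimes>\<^bsub>E\<^esub> inv\<^bsub>E\<^esub> s (h y)"
      using xy inj(1) by (auto simp: pair_def inj_on_def)
    then show "x = y" using xy hxy s[of "h y"] by simp
  qed
  have "\<exists>j. bij_betw j (UNIV \<times> UNIV :: ('u \<times> 'u) set) (UNIV :: 'u set)"
    unfolding card_of_ordIso by (rule card_of_Times_same_infinite[OF inf])
  then obtain j :: "'u \<times> 'u \<Rightarrow> 'u" where "inj j"
    by (auto dest: bij_betw_imp_inj_on)
  then have code: "inj_on (j \<circ> pair) (carrier E)"
    using pair by (intro comp_inj_on) (auto intro: inj_on_subset)
  let ?E0 = "image_group (j \<circ> pair) E" and ?dec = "inv_into (carrier E) (j \<circ> pair)"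
  let ?inc = "inv_into (carrier ?C) \<alpha>"
  have dec: "?dec \<in> iso ?E0 E" and enc: "j \<circ> pair \<in> iso E ?E0"
    using group.iso_set_sym[OF E] inj_imp_image_group_iso[OF code] by auto
  have inc: "?inc \<in> iso A0 ?C" by (rule group.iso_set_sym[OF \<open>group ?C\<close> A0(2)])
  have "group ?E0" by (rule group_image_group[OF E code])
  have inc_E: "?inc \<in> hom A0 E" "?inc ` carrier A0 = kernel E B h" "inj_on ?inc (carrier A0)"
    using inc by (auto simp: iso_def hom_def bij_betw_def kernel_def)
  define q where "q = \<beta> \<circ> (h \<circ> ?dec)"
  define i where "i = (j \<circ> pair) \<circ> ?inc"
  have i_hom: "i \<in> hom A0 ?E0"
    unfolding i_def by (rule Group.hom_compose[OF inc_E(1) iso_imp_homomorphism[OF enc]])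
  have dec_enc: "?dec ((j \<circ> pair) x) = x" if "x \<in> carrier E" for x
    by (rule inv_into_f_f[OF code that])
  have q_hom: "q \<in> hom ?E0 B0"
    unfolding q_def
    by (rule Group.hom_compose[OF Group.hom_compose[OF iso_imp_homomorphism[OF dec] h.homh]
          iso_imp_homomorphism[OF B0(2)]])
  have dec_img: "?dec ` carrier ?E0 = carrier E" using dec by (simp add: iso_def bij_betw_def)
  have q_img: "q ` carrier ?E0 = carrier B0"
    unfolding q_def image_comp[symmetric]
    using h B0(2) dec_img by (simp add: epi_def iso_def bij_betw_def)
  have i_inj: "inj_on i (carrier A0)"
    unfolding i_def
    by (rule comp_inj_on[OF inc_E(3)], unfold inc_E(2), rule inj_on_subset[OF code])
       (auto simp: kernel_def)
  have "kernel ?E0 B0 q = i ` carrier A0"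
  proof -
    have \<beta>_one: "\<beta> b = \<one>\<^bsub>B0\<^esub> \<longleftrightarrow> b = \<one>\<^bsub>B\<^esub>" if "b \<in> carrier B" for b
    proof -
      have "\<beta> \<one>\<^bsub>B\<^esub> = \<one>\<^bsub>B0\<^esub>" using B0(2) hom_one[OF _ B \<open>group B0\<close>] by (auto simp: iso_def)
      then show ?thesis using inj_on_eq_iff[OF inj(2) that h.H.one_closed] by simp
    qed
    have "q ((j \<circ> pair) x) = \<beta> (h x)" if "x \<in> carrier E" for x
      using dec_enc[OF that] by (simp add: q_def)
    then have "kernel ?E0 B0 q = (j \<circ> pair) ` kernel E B h"
      unfolding kernel_def image_group_carrier by (auto simp: \<beta>_one)
    then show ?thesis unfolding i_def image_comp[symmetric, of "j \<circ> pair"] inc_E(2) .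
  qed
  then have "short_exact_sequence B0 ?E0 A0 q i"
    unfolding short_exact_sequence_iff
    using i_hom q_hom q_img i_inj \<open>group A0\<close> \<open>group B0\<close> \<open>group ?E0\<close>
    by (auto simp: epi_def mon_def intro!: group_homI)
  then have "P ?E0" by (rule closed_group_classD(3)[OF P A0(1) B0(1)])
  then show ?thesis using enc by (auto simp: in_group_class_def is_iso_def)
qed


text \<open>Once the fibre over \<open>1\<close> is trivial, \<open>R\<close> is the graph of a homomorphism \<open>\<delta>\<close> with \<open>p \<circ> \<delta> = l\<close>.  It maps the
  kernel of \<open>l\<close> onto the kernel of \<open>p\<close> on the image of \<open>\<delta>\<close> and kills the normal closure of \<open>S\<close>, so
  this image is an extension of its image under \<open>p\<close> by a quotient of \<open>ker l\<close> modulo that normal closure.\<close>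

lemma extension_of_image_in_class:
  fixes P :: "'u monoid \<Rightarrow> bool"
  assumes P: "closed_group_class P" and inf: "infinite (UNIV :: 'u set)"
    and p: "group_hom E G p" and l: "group_hom T G l" and R: "subgroup R (T \<times>\<times> E)"
    and fst_R: "fst ` R = carrier T"
    and over: "\<And>t x. (t, x) \<in> R \<Longrightarrow> p x = l t"
    and single: "\<And>x. (\<one>\<^bsub>T\<^esub>, x) \<in> R \<Longrightarrow> x = \<one>\<^bsub>E\<^esub>"
    and S: "S \<subseteq> kernel T G l" "\<And>t. t \<in> S \<Longrightarrow> (t, \<one>\<^bsub>E\<^esub>) \<in> R"
    and M: "in_group_class P (T\<lparr>carrier := kernel T G l\<rparr> Mod normal_closure T S)"
    and D: "in_group_class P (G\<lparr>carrier := p ` snd ` R\<rparr>)"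
  shows "in_group_class P (E\<lparr>carrier := snd ` R\<rparr>)"
proof -
  interpret p: group_hom E G p by (rule p)
  interpret l: group_hom T G l by (rule l)
  interpret TE: group "T \<times>\<times> E" by (rule DirProd_group) unfold_locales
  interpret R: subgroup R "T \<times>\<times> E" by (rule R)
  let ?K = "kernel T G l" and ?N = "normal_closure T S" and ?D = "snd ` R"
  define \<delta> where "\<delta> t = (THE x. (t, x) \<in> R)" for t
  have R_carrier: "t \<in> carrier T" "x \<in> carrier E" if "(t, x) \<in> R" for t x
    using R.subset that by auto
  have unique: "x = y" if "(t, x) \<in> R" "(t, y) \<in> R" for t x y
  proof -
    have "(\<one>\<^bsub>T\<^esub>, x \<otimes>\<^bsub>E\<^esub> inv\<^bsub>E\<^esub> y) \<in> R"
      using R.m_closed[OF that(1) R.m_inv_closed[OF that(2)]] R_carrier that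
      by (simp add: inv_DirProd[OF l.G.is_group p.G.is_group])
    then have "x \<otimes>\<^bsub>E\<^esub> inv\<^bsub>E\<^esub> y = \<one>\<^bsub>E\<^esub>" by (rule single)
    then show ?thesis using R_carrier that p.G.inv_equality by fastforce
  qed
  have \<delta>_R: "(t, \<delta> t) \<in> R" if "t \<in> carrier T" for t
  proof -
    have "\<exists>x. (t, x) \<in> R" using fst_R that by force
    then have "\<exists>!x. (t, x) \<in> R" using unique by blast
    then show ?thesis unfolding \<delta>_def by (rule theI')
  qed
  have \<delta>_eq: "\<delta> t = x" if "(t, x) \<in> R" for t x
    using unique[OF \<delta>_R that] R_carrier that by blast
  have \<delta>_hom: "\<delta> \<in> hom T E"
  proof (rule homI)
    show "\<delta> (t \<otimes>\<^bsub>T\<^esub> u) = \<delta> t \<otimes>\<^bsub>E\<^esub> \<delta> u" if "t \<in> carrier T" "u \<in> carrier T" for t u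
      using R.m_closed[OF \<delta>_R \<delta>_R] that by (intro \<delta>_eq) simp
  qed (use \<delta>_R R_carrier in blast)
  interpret \<delta>: group_hom T E \<delta> by (rule group_homI[OF l.G.is_group p.G.is_group \<delta>_hom])
  have image: "\<delta> ` carrier T = ?D"
  proof
    show "\<delta> ` carrier T \<subseteq> ?D" using \<delta>_R by force
    show "?D \<subseteq> \<delta> ` carrier T"
    proof
      fix x assume "x \<in> ?D"
      then obtain t where "(t, x) \<in> R" by auto
      then show "x \<in> \<delta> ` carrier T" using \<delta>_eq[of t x] R_carrier(1)[of t x] by blast
    qed
  qed
  have "subgroup ?D E" using \<delta>.img_is_subgroup by (simp add: image)
  then interpret D: subgroup ?D E .
  have p\<delta>: "p (\<delta> t) = l t" if "t \<in> carrier T" for t using over \<delta>_R that by blast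
  let ?C = "kernel (E\<lparr>carrier := ?D\<rparr>) (G\<lparr>carrier := p ` ?D\<rparr>) p"
  have \<delta>K: "\<delta> ` ?K = ?C"
    using p\<delta> by (auto simp: kernel_def simp flip: image)
  have S_T: "S \<subseteq> carrier T" using S(1) by (auto simp: kernel_def)
  have N_T: "?N \<lhd> T" by (rule l.G.normal_closure_normal[OF S_T])
  have N_K: "?N \<subseteq> ?K" by (rule l.G.normal_closure_least[OF l.normal_kernel S(1)])
  have "S \<subseteq> kernel T E \<delta>" using S_T S(2) \<delta>_eq by (auto simp: kernel_def)
  then have N_\<delta>: "?N \<subseteq> kernel T E \<delta>" by (rule l.G.normal_closure_least[OF \<delta>.normal_kernel])
  let ?T = "T\<lparr>carrier := ?K\<rparr>" and ?E = "E\<lparr>carrier := ?D\<rparr>"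
  have N: "?N \<lhd> ?T" by (rule l.G.normal_restrict_supergroup[OF l.subgroup_kernel N_T N_K])
  have groups: "group ?T" "group ?E" "group (G\<lparr>carrier := p ` ?D\<rparr>)"
    using l.G.subgroup_imp_group[OF l.subgroup_kernel] p.G.subgroup_imp_group[OF \<open>subgroup ?D E\<close>]
      p.H.subgroup_imp_group[OF p.subgroup_img_is_subgroup[OF \<open>subgroup ?D E\<close>]] .
  have p_epi: "p \<in> epi ?E (G\<lparr>carrier := p ` ?D\<rparr>)"
    by (auto simp: epi_def hom_def)
  interpret pD: group_hom ?E "G\<lparr>carrier := p ` ?D\<rparr>" p
    using p_epi by (intro group_homI groups) (simp add: epi_def)
  let ?EC = "?E\<lparr>carrier := ?C\<rparr>"
  have group_EC: "group ?EC" by (rule pD.G.subgroup_imp_group[OF pD.subgroup_kernel])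
  have \<delta>_hom_K: "\<delta> \<in> hom ?T ?EC"
    using \<delta>K by (auto simp: hom_def kernel_def)
  have "\<delta> t = \<delta> u" if "t \<in> carrier ?T" "u \<in> carrier ?T" "?N #>\<^bsub>?T\<^esub> t = ?N #>\<^bsub>?T\<^esub> u" for t u
  proof -
    have "t \<in> ?N #>\<^bsub>T\<^esub> u"
      using that l.G.rcos_self[OF _ normal_imp_subgroup[OF N_T], of t] by (simp add: kernel_def)
    then show ?thesis using N_\<delta> that by (auto simp: r_coset_def kernel_def)
  qed
  then obtain g where g: "g \<in> hom (?T Mod ?N) ?EC"
    "\<And>t. t \<in> carrier ?T \<Longrightarrow> g (?N #>\<^bsub>?T\<^esub> t) = \<delta> t"
    using FactGroup_universal[OF \<delta>_hom_K N] by blast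
  have "g ` carrier (?T Mod ?N) = \<delta> ` carrier ?T"
    unfolding carrier_FactGroup image_image using g(2) by (intro image_cong) auto
  also have "\<dots> = ?C" using \<delta>K by simp
  finally have "g \<in> epi (?T Mod ?N) ?EC" using g(1) by (simp add: epi_def)
  then have "in_group_class P ?EC"
    by (rule closed_group_class_quotient[OF P M normal.factorgroup_is_group[OF N] group_EC])
  then show ?thesis
    by (rule closed_group_class_extension[OF P inf groups(2,3) p_epi _ D])
qed


section \<open>Lower central and derived terms of an extension\<close>

theorem corollary4p3:
  fixes n :: nat and P :: "'u monoid \<Rightarrow> bool"
    and \<Gamma> :: "'c monoid" and G :: "'a monoid" and G' :: "'b monoid"
    and f :: "'c \<Rightarrow> 'a" and p :: "'b \<Rightarrow> 'a"
  assumes "n \<ge> 2"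
    and "infinite (UNIV :: 'u set)"
    and "closed_group_class P"
    and "group \<Gamma>" and "group G" and "group G'"
    and "f \<in> hom \<Gamma> G"
    and "f_extension \<Gamma> G f G' p"
  shows
    "(kernel G' G p \<subseteq> upper_central G' (n - 1) \<and>
      in_group_class P (M_tensor \<Gamma> G f n) \<and>
      in_group_class P (G\<lparr>carrier := lower_central G n\<rparr>)
      \<longrightarrow> in_group_class P (G'\<lparr>carrier := lower_central G' n\<rparr>))
   \<and> (kernel G' G p \<subseteq> derived_annihilator G' (n - 1) \<and>
      in_group_class P (M_wedge \<Gamma> G f n) \<and>
      in_group_class P (G\<lparr>carrier := derived_series G n\<rparr>)
      \<longrightarrow> in_group_class P (G'\<lparr>carrier := derived_series G' n\<rparr>))"
proof -
  obtain f' where p: "p \<in> epi G' G" and f': "f' \<in> hom \<Gamma> G'"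
    and f'_lift: "\<And>x. x \<in> carrier \<Gamma> \<Longrightarrow> p (f' x) = f x"
    using assms(8) by (auto simp: f_extension_def)
  interpret group_epimorphism G' G p
    using assms(5,6) p by (intro group_epimorphism.intro group_epimorphism_axioms.intro)
  have f: "group_hom \<Gamma> G f" by (rule group_homI[OF assms(4,5,7)])
  interpret f': group_hom \<Gamma> G' f' by (rule group_homI[OF assms(4,6) f'])
  define k where "k = n - 1"
  have n: "n = Suc k" using assms(1) by (simp add: k_def)
  show ?thesis
  proof (intro conjI impI; elim conjE)
    assume ker: "kernel G' G p \<subseteq> upper_central G' (n - 1)"
      and M: "in_group_class P (M_tensor \<Gamma> G f n)"
      and D: "in_group_class P (G\<lparr>carrier := lower_central G n\<rparr>)"
    let ?T = "stage_group (tensor_stages G k)" and ?l = "stage_lambda (tensor_stages G k)"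
    let ?S = "tensor_stage_map \<Gamma> G f k ` K_tensor \<Gamma> n"
    interpret S: crossed_stage G "tensor_stages G k" by (rule crossed_stage_G)
    have K: "t \<in> carrier (stage_group (tensor_stages \<Gamma> k))"
      "stage_lambda (tensor_stages \<Gamma> k) t = \<one>\<^bsub>\<Gamma>\<^esub>" if "t \<in> K_tensor \<Gamma> n" for t
      using that by (auto simp: K_tensor_def kernel_def tensor_power_def tensor_lambda_def n)
    have lift: "(tensor_stage_map \<Gamma> G f k t, \<one>\<^bsub>G'\<^esub>) \<in> tensor_lifts k" if "t \<in> K_tensor \<Gamma> n" for t
      using tensor_lifts_natural[OF assms(4) f' f f'_lift K(1)[OF that]] K(2)[OF that] by simp
    have "in_group_class P (G'\<lparr>carrier := snd ` tensor_lifts k\<rparr>)"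
    proof (rule extension_of_image_in_class[OF assms(3,2) p.group_hom_axioms
          group_homI[OF S.group_stage G.is_group S.lambda_hom]
          tensor_lifts_subgroup fst_tensor_lifts tensor_lifts_over_lambda])
      show "x = \<one>\<^bsub>G'\<^esub>" if "(\<one>\<^bsub>?T\<^esub>, x) \<in> tensor_lifts k" for x
        using tensor_lifts_of_one[OF ker, of k x] that by (simp add: n)
      show "(t, \<one>\<^bsub>G'\<^esub>) \<in> tensor_lifts k" if "t \<in> ?S" for t
        using that lift by blast
      then show "?S \<subseteq> kernel ?T G ?l"
        using tensor_lifts_over_lambda fst_tensor_lifts[of k]
        by (force simp: kernel_def)
      show "in_group_class P (?T\<lparr>carrier := kernel ?T G ?l\<rparr> Mod normal_closure ?T ?S)"
        using M by (simp add: M_tensor_def K_tensor_def N_tensor_def tensor_power_def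
            tensor_lambda_def tensor_power_map_def n)
      show "in_group_class P (G\<lparr>carrier := p ` snd ` tensor_lifts k\<rparr>)"
        using D p.lower_central_img[OF p_surj, of k] by (simp add: snd_tensor_lifts n)
    qed
    then show "in_group_class P (G'\<lparr>carrier := lower_central G' n\<rparr>)"
      by (simp add: snd_tensor_lifts n)
  next
    assume ker: "kernel G' G p \<subseteq> derived_annihilator G' (n - 1)"
      and M: "in_group_class P (M_wedge \<Gamma> G f n)"
      and D: "in_group_class P (G\<lparr>carrier := derived_series G n\<rparr>)"
    let ?T = "wedge_stage G k" and ?l = "wedge_stage_mu G k"
    let ?S = "wedge_stage_map \<Gamma> G f k ` K_wedge \<Gamma> n"
    have K: "t \<in> carrier (wedge_stage \<Gamma> k)"
      "wedge_stage_mu \<Gamma> k t = \<one>\<^bsub>\<Gamma>\<^esub>" if "t \<in> K_wedge \<Gamma> n" for t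
      using that by (auto simp: K_wedge_def kernel_def exterior_power_def exterior_mu_def n)
    have lift: "(wedge_stage_map \<Gamma> G f k t, \<one>\<^bsub>G'\<^esub>) \<in> wedge_lifts k" if "t \<in> K_wedge \<Gamma> n" for t
      using wedge_lifts_natural[OF assms(4) f' f f'_lift K(1)[OF that]] K(2)[OF that] by simp
    have ker': "kernel G' G p \<subseteq> annihilator_term G' k 0"
      using ker E.derived_annihilator_subset[of k] by (simp add: n)
    have "in_group_class P (G'\<lparr>carrier := snd ` wedge_lifts k\<rparr>)"
    proof (rule extension_of_image_in_class[OF assms(3,2) p.group_hom_axioms
          group_homI[OF group_wedge_stage[OF G.is_group] G.is_group wedge_mu_hom[OF G.is_group]]
          wedge_lifts_subgroup fst_wedge_lifts wedge_lifts_over_mu])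
      show "x = \<one>\<^bsub>G'\<^esub>" if "(\<one>\<^bsub>?T\<^esub>, x) \<in> wedge_lifts k" for x
        using wedge_lifts_of_one[OF ker', of k x] that by simp
      show "(t, \<one>\<^bsub>G'\<^esub>) \<in> wedge_lifts k" if "t \<in> ?S" for t
        using that lift by blast
      then show "?S \<subseteq> kernel ?T G ?l"
        using wedge_lifts_over_mu fst_wedge_lifts[of k]
        by (force simp: kernel_def)
      show "in_group_class P (?T\<lparr>carrier := kernel ?T G ?l\<rparr> Mod normal_closure ?T ?S)"
        using M by (simp add: M_wedge_def K_wedge_def N_wedge_def exterior_power_def
            exterior_mu_def exterior_power_map_def n)
      show "in_group_class P (G\<lparr>carrier := p ` snd ` wedge_lifts k\<rparr>)"
        using D p.derived_series_img[OF p_surj, of k] by (simp add: snd_wedge_lifts n)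
    qed
    then show "in_group_class P (G'\<lparr>carrier := derived_series G' n\<rparr>)"
      by (simp add: snd_wedge_lifts n)
  qed
qed

end
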